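(* Let $V$ be the $\mathcal O_q$-module, with all associated notation ($d$, $a$, $V_i$, $V^*_i$, $V^+_i$, $K$, $B$, $K^\downarrow$, $B^\downarrow$, and the flags $[0],[d],[0^*],[d^*],[0^+],[d^+]$), described in the context. Put $$N=\frac{a^{-1}K^{-1}-aB^{-1}}{a^{-1}-a},\qquad N^\downarrow=\frac{a^{-1}(K^\downarrow)^{-1}-a(B^\downarrow)^{-1}}{a^{-1}-a}.$$ Then, in the sense of "goes from flag to flag" defined in the context: (1) $B$ goes from $[0^*]$ to $[0]$; $K$ goes from $[0^*]$ to $[d]$; $B^\downarrow$ goes from $[d^*]$ to $[0]$; $K^\downarrow$ goes from $[d^*]$ to $[d]$; (2) $aA-a^2B^{-1}$ goes from $[0^+]$ to $[0]$; $a^{-1}A-a^{-2}K^{-1}$ goes from $[0^+]$ to $[d]$; $aA-a^2(B^\downarrow)^{-1}$ goes from $[d^+]$ to $[0]$; $a^{-1}A-a^{-2}(K^\downarrow)^{-1}$ goes from $[d^+]$ to $[d]$; (3) $N$ goes from $[0^+]$ to $[0^*]$; $N^\downarrow$ goes from $[d^+]$ to $[d^*]$.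
   Context: Setting. $\mathbb F$ is a field and $q\in\mathbb F$ is nonzero and not a root of unity. Algebras are associative, unital, over $\mathbb F$. Write $[X,Y]=XY-YX$, $[X,Y]_q=qXY-q^{-1}YX$, $[X,Y]_{q^{-1}}=q^{-1}XY-qYX$. The $q$-Onsager algebra $\mathcal O_q$ is defined by generators $A,A^*$ and relations $[A,[A,[A,A^*]_q]_{q^{-1}}]=(q^2-q^{-2})^2[A^*,A]$ and $[A^*,[A^*,[A^*,A]_q]_{q^{-1}}]=(q^2-q^{-2})^2[A,A^*]$. $V$ is an irreducible $\mathcal O_q$-module of finite dimension at least $2$ on which each of $A,A^*$ is diagonalizable; elements of $\mathcal O_q$ are identified with their actions on $V$. Eigenspaces. The eigenvalues of $A$ on $V$ can be ordered as mutually distinct $\theta_0,\dots,\theta_d$ ($d\ge 1$) such that $\theta_i=aq^{d-2i}+a^{-1}q^{2i-d}$ ($0\le i\le d$) for some nonzero $a\in\mathbb F$; fix such an ordering and $a$. $V_i$ is the $\theta_i$-eigenspace of $A$ and $E_i\in\mathrm{End}(V)$ is the projection onto $V_i$ along $\bigoplus_{j\ne i}V_j$; one has $A^*V_i\subseteq V_{i-1}+V_i+V_{i+1}$ ($V_{-1}=V_{d+1}=0$). $A^*$ also has exactly $d+1$ eigenspaces on $V$, and they can be ordered $V^*_0,\dots,V^*_d$ so that $AV^*_i\subseteq V^*_{i-1}+V^*_i+V^*_{i+1}$ ($V^*_{-1}=V^*_{d+1}=0$); fix such an ordering and let $\theta_i^*$ be the eigenvalue of $A^*$ on $V^*_i$.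 One has $a^2\ne 1$. Lusztig automorphism. $L$ is the automorphism of $\mathcal O_q$ with $L(A)=A$, $L(A^* )=A^*+\frac{[A,[A,A^*]_q]}{(q-q^{-1})(q^2-q^{-2})}$. The map $H$. Let $t_{ij}=1+\frac{\theta_i-\theta_j}{q-q^{-1}}\cdot\frac{q\theta_i-q^{-1}\theta_j}{q^2-q^{-2}}$, $t_i=t_{01}t_{12}\cdots t_{i-1,i}$ ($t_0=1$), and $H=\sum_{i=0}^d t_iE_i\in\mathrm{End}(V)$; each $t_i\neq0$, so $H$ is invertible. Put $V^+_i=H^{-1}V^*_i$ ($0\le i\le d$); $V^+_i$ is the eigenspace of $L(A^* )$ on $V$ with eigenvalue $\theta^*_i$. Maps. A decomposition of $V$ is a sequence $\{W_i\}_{i=0}^d$ of nonzero subspaces with direct sum $V$; its corresponding map is the $M\in\mathrm{End}(V)$ acting on $W_i$ as $q^{d-2i}$ times the identity ($0\le i\le d$). $K,B,K^\downarrow,B^\downarrow$ are the maps corresponding to the decompositions $\{W_i\}_{i=0}^d$ (each known to be a decomposition) given respectively by: $K$: $W_i=(V^*_0+\cdots+V^*_i)\cap(V_i+\cdots+V_d)$; $B$: $W_i=(V^*_0+\cdots+V^*_i)\cap(V_0+\cdots+V_{d-i})$; $K^\downarrow$: $W_i=(V^*_{d-i}+\cdots+V^*_d)\cap(V_i+\cdots+V_d)$; $B^\downarrow$: $W_i=(V^*_{d-i}+\cdots+V^*_d)\cap(V_0+\cdots+V_{d-i})$. Flags. For $0\le i\le d$ put $[0]_i=V_0+\cdots+V_i$,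 $[d]_i=V_{d-i}+\cdots+V_d$, $[0^*]_i=V^*_0+\cdots+V^*_i$, $[d^*]_i=V^*_{d-i}+\cdots+V^*_d$, $[0^+]_i=V^+_0+\cdots+V^+_i$, $[d^+]_i=V^+_{d-i}+\cdots+V^+_d$; these define flags $[0],[d],[0^*],[d^*],[0^+],[d^+]$. Given flags $F=(F_i)_{i=0}^d$, $G=(G_i)_{i=0}^d$, say $M\in\mathrm{End}(V)$ goes from $F$ to $G$ if $M$ is diagonalizable with eigenvalues $\{q^{d-2i}\}_{i=0}^d$ and, writing $M_i$ for its $q^{d-2i}$-eigenspace, $M_0+\cdots+M_i=F_i$ and $M_{d-i}+\cdots+M_d=G_i$ for $0\le i\le d$. *)

theory Defs
  imports
    "HOL-Library.Poly_Mapping"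
    "HOL-Library.Set_Algebras"
    "HOL-Algebra.QuotRing"
    "HOL-Algebra.Algebraic_Closure_Type"
begin

section \<open>The q-Onsager algebra by generators and relations\<close>

text \<open>
  Words form the free monoid under concatenation (written additively, as required by
  \<open>Poly_Mapping\<close>), so finitely supported functions on words with the
  convolution product form the free associative unital algebra.
\<close>

datatype 'g word = Word (letters: "'g list")

instantiation word :: (type) monoid_add
begin

definition zero_word :: "'a word" where
  "0 = Word []"

definition plus_word :: "'a word \<Rightarrow> 'a word \<Rightarrow> 'a word" where
  "u + w = Word (letters u @ letters w)"

instance
  by standard (auto simp: zero_word_def plus_word_def)

end

datatype onsager_gen = Gen_A | Gen_Astar

type_synonym 'f onsager_free = "onsager_gen word \<Rightarrow>\<^sub>0 'f"

definition free_scal :: "'f::field \<Rightarrow> 'f onsager_free" where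
  "free_scal c = Poly_Mapping.single 0 c"

definition free_gen :: "onsager_gen \<Rightarrow> ('f::field) onsager_free" where
  "free_gen g = Poly_Mapping.single (Word [g]) 1"

definition comm :: "'r::ring_1 \<Rightarrow> 'r \<Rightarrow> 'r" where
  "comm x y = x * y - y * x"

definition qcomm :: "'f::field \<Rightarrow> 'f onsager_free \<Rightarrow> 'f onsager_free \<Rightarrow> 'f onsager_free" where
  "qcomm r x y = free_scal r * x * y - free_scal (inverse r) * y * x"

definition onsager_relator ::
    "'f::field \<Rightarrow> 'f onsager_free \<Rightarrow> 'f onsager_free \<Rightarrow> 'f onsager_free" where
  "onsager_relator q x y =
     comm x (qcomm (inverse q) x (qcomm q x y))
       - free_scal ((q\<^sup>2 - inverse (q\<^sup>2))\<^sup>2) * comm y x"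

definition onsager_ideal :: "'f::field \<Rightarrow> ('f onsager_free) set" where
  "onsager_ideal q =
     genideal ring_of_type_algebra
       {onsager_relator q (free_gen Gen_A) (free_gen Gen_Astar),
        onsager_relator q (free_gen Gen_Astar) (free_gen Gen_A)}"

definition onsager_algebra :: "'f::field \<Rightarrow> ('f onsager_free) set ring" where
  "onsager_algebra q = ring_of_type_algebra Quot onsager_ideal q"

definition onsager_class :: "'f::field \<Rightarrow> 'f onsager_free \<Rightarrow> ('f onsager_free) set" where
  "onsager_class q x = onsager_ideal q +>\<^bsub>ring_of_type_algebra\<^esub> x"

section \<open>Modules\<close>

text \<open>The vector space is the whole type \<open>'v\<close>, with scalar multiplication \<open>scale\<close>.\<close>

definition End_ring :: "('f::field \<Rightarrow> 'v::ab_group_add \<Rightarrow> 'v) \<Rightarrow> ('v \<Rightarrow> 'v) ring" where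
  "End_ring scale =
     \<lparr>carrier = {f. Vector_Spaces.linear scale scale f},
      monoid.mult = (\<circ>), one = id, zero = (\<lambda>v. 0), add = (\<lambda>f g v. f v + g v)\<rparr>"

text \<open>
  A module structure is a homomorphism of unital \<open>'f\<close>-algebras to the endomorphism algebra;
  the condition on scalars makes the ring homomorphism \<open>'f\<close>-linear.
\<close>

definition onsager_module ::
    "('f::field \<Rightarrow> 'v::ab_group_add \<Rightarrow> 'v) \<Rightarrow> 'f \<Rightarrow> (('f onsager_free) set \<Rightarrow> 'v \<Rightarrow> 'v) \<Rightarrow> bool"
  where
  "onsager_module scale q \<rho> \<longleftrightarrow>
     vector_space scale \<and>
     \<rho> \<in> ring_hom (onsager_algebra q) (End_ring scale) \<and>
     (\<forall>c. \<rho> (onsager_class q (free_scal c)) = scale c)"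

definition irreducible_onsager_module ::
    "('f::field \<Rightarrow> 'v::ab_group_add \<Rightarrow> 'v) \<Rightarrow> 'f \<Rightarrow> (('f onsager_free) set \<Rightarrow> 'v \<Rightarrow> 'v) \<Rightarrow> bool"
  where
  "irreducible_onsager_module scale q \<rho> \<longleftrightarrow>
     onsager_module scale q \<rho> \<and>
     (UNIV :: 'v set) \<noteq> {0} \<and>
     (\<forall>W. module.subspace scale W \<and> (\<forall>x\<in>carrier (onsager_algebra q). \<rho> x ` W \<subseteq> W)
        \<longrightarrow> W = {0} \<or> W = UNIV)"

definition finite_dim_space :: "('f::field \<Rightarrow> 'v::ab_group_add \<Rightarrow> 'v) \<Rightarrow> bool" where
  "finite_dim_space scale \<longleftrightarrow> (\<exists>S. finite S \<and> module.span scale S = UNIV)"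

section \<open>Eigenspaces and diagonalizability\<close>

definition eigenspace ::
    "('f::field \<Rightarrow> 'v::ab_group_add \<Rightarrow> 'v) \<Rightarrow> ('v \<Rightarrow> 'v) \<Rightarrow> 'f \<Rightarrow> 'v set" where
  "eigenspace scale f c = {v. f v = scale c v}"

definition eigenvalues ::
    "('f::field \<Rightarrow> 'v::ab_group_add \<Rightarrow> 'v) \<Rightarrow> ('v \<Rightarrow> 'v) \<Rightarrow> 'f set" where
  "eigenvalues scale f = {c. \<exists>v. v \<noteq> 0 \<and> f v = scale c v}"

definition diagonalizable ::
    "('f::field \<Rightarrow> 'v::ab_group_add \<Rightarrow> 'v) \<Rightarrow> ('v \<Rightarrow> 'v) \<Rightarrow> bool" where
  "diagonalizable scale f \<longleftrightarrow>
     Vector_Spaces.linear scale scale f \<and>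
     (\<exists>S. \<not> module.dependent scale S \<and> module.span scale S = UNIV \<and>
          (\<forall>b\<in>S. \<exists>c. f b = scale c b))"

section \<open>Decompositions and flags\<close>

text \<open>
  Sums of subspaces, such as \<open>\<Sum>j\<le>i. W j\<close> for \<open>W :: nat \<Rightarrow> 'v set\<close>, are the
  elementwise sums provided by \<open>Set_Algebras\<close>.
\<close>

text \<open>The map is determined uniquely as soon as \<open>W 0, \<dots>, W d\<close> is a decomposition.\<close>

definition decomp_map ::
    "('f::field \<Rightarrow> 'v::ab_group_add \<Rightarrow> 'v) \<Rightarrow> 'f \<Rightarrow> nat \<Rightarrow> (nat \<Rightarrow> 'v set) \<Rightarrow> 'v \<Rightarrow> 'v" where
  "decomp_map scale q d W =
     (THE M. Vector_Spaces.linear scale scale M \<and>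
        (\<forall>i\<le>d. \<forall>w\<in>W i. M w = scale (q powi (int d - 2 * int i)) w))"

definition decomp_proj ::
    "('f::field \<Rightarrow> 'v::ab_group_add \<Rightarrow> 'v) \<Rightarrow> nat \<Rightarrow> (nat \<Rightarrow> 'v set) \<Rightarrow> nat \<Rightarrow> 'v \<Rightarrow> 'v" where
  "decomp_proj scale d W i =
     (THE P. Vector_Spaces.linear scale scale P \<and>
        (\<forall>w\<in>W i. P w = w) \<and> (\<forall>j\<le>d. j \<noteq> i \<longrightarrow> (\<forall>w\<in>W j. P w = 0)))"

definition flag_up :: "(nat \<Rightarrow> 'v::ab_group_add set) \<Rightarrow> nat \<Rightarrow> 'v set" where
  "flag_up W i = (\<Sum>j\<le>i. W j)"

definition flag_down :: "nat \<Rightarrow> (nat \<Rightarrow> 'v::ab_group_add set) \<Rightarrow> nat \<Rightarrow> 'v set" where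
  "flag_down d W i = (\<Sum>j\<in>{d-i..d}. W j)"

definition goes_from_to ::
    "('f::field \<Rightarrow> 'v::ab_group_add \<Rightarrow> 'v) \<Rightarrow> 'f \<Rightarrow> nat \<Rightarrow> ('v \<Rightarrow> 'v) \<Rightarrow>
     (nat \<Rightarrow> 'v set) \<Rightarrow> (nat \<Rightarrow> 'v set) \<Rightarrow> bool" where
  "goes_from_to scale q d M F G \<longleftrightarrow>
     diagonalizable scale M \<and>
     eigenvalues scale M = (\<lambda>i. q powi (int d - 2 * int i)) ` {..d} \<and>
     (let E = (\<lambda>i. eigenspace scale M (q powi (int d - 2 * int i)))
      in \<forall>i\<le>d. (\<Sum>j\<le>i. E j) = F i \<and> (\<Sum>j\<in>{d-i..d}. E j) = G i)"

section \<open>The map H\<close>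

definition t_pair :: "'f::field \<Rightarrow> (nat \<Rightarrow> 'f) \<Rightarrow> nat \<Rightarrow> nat \<Rightarrow> 'f" where
  "t_pair q \<theta> i j =
     1 + (\<theta> i - \<theta> j) / (q - inverse q) *
         ((q * \<theta> i - inverse q * \<theta> j) / (q\<^sup>2 - inverse (q\<^sup>2)))"

definition t_coeff :: "'f::field \<Rightarrow> (nat \<Rightarrow> 'f) \<Rightarrow> nat \<Rightarrow> 'f" where
  "t_coeff q \<theta> i = (\<Prod>k=1..i. t_pair q \<theta> (k - 1) k)"

definition H_map ::
    "('f::field \<Rightarrow> 'v::ab_group_add \<Rightarrow> 'v) \<Rightarrow> 'f \<Rightarrow> nat \<Rightarrow> (nat \<Rightarrow> 'f) \<Rightarrow> (nat \<Rightarrow> 'v set) \<Rightarrow>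
     'v \<Rightarrow> 'v" where
  "H_map scale q d \<theta> V v =
     (\<Sum>i\<le>d. scale (t_coeff q \<theta> i) (decomp_proj scale d V i v))"

end

theory Submission
  imports Defs
begin

text \<open>
  A linear map goes from one flag to another as soon as it is triangular with the right diagonals
  on both flags: if \<open>M\<close> preserves the flag \<open>F\<close> and acts on its successive quotients by
  distinct scalars, then the partial sums of the eigenspaces of \<open>M\<close>, taken in that order, are
  the members of \<open>F\<close> (\<open>triangular_eigenspaces\<close>, \<open>goes_from_toI\<close>). So every claim
  becomes a computation of diagonals, and those are additive and compatible with inverses.

  For \<open>B\<close> and its three companions the diagonals can be read off the split decomposition
  \<open>W i = (V*_0 + ... + V*_i) \<inter> (V_0 + ... + V_(d-i))\<close>. That it is a decomposition is where
  irreducibility enters: the spans of the intersections of members of the two flags whose indices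
  have a fixed sum are invariant under \<open>A\<close> and \<open>A*\<close>, hence zero or everything
  (\<open>antidiagonal_cases\<close>). This uses that \<open>A*\<close> is tridiagonal on the eigenspaces of
  \<open>A\<close>, which is a consequence of the first defining relation of the algebra
  (\<open>Astar_tridiagonal\<close>).

  The heart is the identity \<open>H (a A - a^2 B^-1) = B H\<close> (\<open>H_Bplus\<close>). It says that
  \<open>B+ = a A - a^2 B^-1\<close> is conjugate to \<open>B\<close> under \<open>H\<close>; since \<open>H\<close> pulls
  \<open>[0*]\<close> back to \<open>[0+]\<close>, the behaviour of \<open>B\<close> on \<open>[0*]\<close> becomes that of
  \<open>B+\<close> on \<open>[0+]\<close>. On the split decomposition \<open>A\<close> is bidiagonal, and this gives
  \<open>q B A - q^-1 A B = (q - q^-1) (a + a^-1 B^2)\<close>. The map \<open>B+\<close> satisfies the same relation,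
  and so the defect \<open>D = H B+ - B H\<close> satisfies the linear relation
  \<open>q D A - q^-1 A D = (q - q^-1) a^-1 (D B+ + B D)\<close>. Suppose that \<open>D\<close> lowers the index in
  \<open>[0]\<close> by at least \<open>k\<close>, with \<open>k \<ge> 2\<close>. Comparing leading terms, this
  relation multiplies the leading term of \<open>D\<close> by a nonzero scalar and makes the result vanish, so
  \<open>D\<close> lowers by \<open>k + 1\<close>; eventually \<open>D = 0\<close>. The scalar is zero for \<open>k = 1\<close>, and it
  is exactly the recursion \<open>t_i = t_(i-1) t_(i-1,i)\<close> that makes \<open>D\<close> lower by two to
  begin with (\<open>D_eigen\<close>).

  Reversing the order of the eigenspaces of \<open>A\<close> replaces \<open>a\<close> by its inverse and \<open>B\<close> by
  \<open>K\<close>, and changes \<open>H\<close> by a scalar only; reversing the order of the eigenspaces of \<open>A*\<close>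
  gives the two remaining maps. Finally, with \<open>c (a^-1 - a) = 1\<close> and with \<open>K+\<close> denoting the
  analogue of \<open>B+\<close> for \<open>K\<close>, one has \<open>N = c a^-1 K^-1 - c a B^-1 = c a^-1 B+ - c a K+\<close>. The
  coefficients sum to one, so \<open>N\<close> inherits the common diagonal of \<open>K^-1\<close> and \<open>B^-1\<close> on
  \<open>[0*]\<close> and the common diagonal of \<open>B+\<close> and \<open>K+\<close> on \<open>[0+]\<close>.
\<close>

section \<open>Flags and triangular maps\<close>

text \<open>
  A copy of \<open>vector_space\<close>: what is declared here stays out of the many existing interpretations
  of that locale.
\<close>

locale scalar_space = vector_space scale
  for scale :: "'a::field \<Rightarrow> 'b::ab_group_add \<Rightarrow> 'b" (infixr \<open>*s\<close> 75)
begin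

abbreviation endo :: "('b \<Rightarrow> 'b) \<Rightarrow> bool" where
  "endo f \<equiv> Vector_Spaces.linear scale scale f"

lemma endoI:
  assumes "\<And>x y. f (x + y) = f x + f y" "\<And>c x. f (c *s x) = c *s f x"
  shows "endo f"
  using assms vector_space_axioms by (simp add: Vector_Spaces.linear_iff)

lemma endo_add: "endo f \<Longrightarrow> f (x + y) = f x + f y"
  and endo_scale: "endo f \<Longrightarrow> f (c *s x) = c *s f x"
  by (simp_all add: Vector_Spaces.linear_iff)

lemma endo_module_hom: "endo f \<Longrightarrow> module_hom scale scale f"
  by (simp add: module_hom_iff_linear)

lemma endo_zero: "endo f \<Longrightarrow> f 0 = 0"
  and endo_diff: "endo f \<Longrightarrow> f (x - y) = f x - f y"
  and endo_sum: "endo f \<Longrightarrow> f (sum g S) = (\<Sum>j\<in>S. f (g j))"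
  by (erule endo_module_hom[THEN module_hom.zero] endo_module_hom[THEN module_hom.diff]
      endo_module_hom[THEN module_hom.sum])+

lemmas endo_simps = endo_add endo_scale endo_zero endo_diff

lemma endo_scaled_diff: "endo f \<Longrightarrow> endo g \<Longrightarrow> endo (\<lambda>v. b *s f v - c *s g v)"
  by (rule endoI) (simp_all add: endo_simps algebra_simps)

lemma endo_inv:
  assumes "endo f" "bij f"
  shows "endo (inv_into UNIV f)"
proof (rule endoI)
  fix x y c
  have f_inv: "f (inv_into UNIV f z) = z" for z
    using assms(2) by (simp add: bij_is_surj surj_f_inv_f)
  show "inv_into UNIV f (x + y) = inv_into UNIV f x + inv_into UNIV f y"
    by (rule inv_f_eq[OF bij_is_inj[OF assms(2)]]) (simp add: endo_simps[OF assms(1)] f_inv)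
  show "inv_into UNIV f (c *s x) = c *s inv_into UNIV f x"
    by (rule inv_f_eq[OF bij_is_inj[OF assms(2)]]) (simp add: endo_simps[OF assms(1)] f_inv)
qed

lemma subspace_vimage:
  assumes "endo f" "subspace S"
  shows "subspace {v. f v \<in> S}"
  using assms by (auto simp: subspace_def endo_simps)

lemma subspace_eigenspace: "endo f \<Longrightarrow> subspace (eigenspace scale f c)"
  by (auto simp: subspace_def eigenspace_def endo_simps scale_right_distrib scale_left_commute)

lemma set_sum_eq_span:
  assumes "finite I" "\<And>j. j \<in> I \<Longrightarrow> subspace (W j)"
  shows "(\<Sum>j\<in>I. W j) = span (\<Union>j\<in>I. W j)"
  using assms
proof (induction I rule: finite_induct)
  case empty
  then show ?case by (simp add: set_zero)
next
  case (insert x I)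
  have sub: "subspace (W x)" using insert.prems by simp
  have "(\<Sum>j\<in>insert x I. W j) = W x + span (\<Union>j\<in>I. W j)"
    using insert by simp
  also have "\<dots> = span (W x) + span (\<Union>j\<in>I. W j)"
    by (simp only: span_eq_iff[THEN iffD2, OF sub])
  also have "\<dots> = span (W x \<union> (\<Union>j\<in>I. W j))"
    unfolding span_Un set_plus_def by auto
  finally show ?case by simp
qed

text \<open>
  Applying \<open>f - c n\<close> to a vanishing sum of eigenvectors kills its last term and multiplies the
  others by nonzero scalars, which is the induction step.
\<close>

lemma independent_eigenvectors:
  fixes n :: nat
  assumes "endo f" "inj_on c {..<n}"
    and "\<And>i. i < n \<Longrightarrow> f (s i) = c i *s s i" "(\<Sum>i<n. s i) = 0" "i < n"
  shows "s i = 0"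
  using assms(2-)
proof (induction n arbitrary: s i)
  case 0
  then show ?case by simp
next
  case (Suc n)
  have "0 = f (\<Sum>i<Suc n. s i) - c n *s (\<Sum>i<Suc n. s i)"
    using Suc.prems(3) by (simp add: endo_simps[OF assms(1)])
  also have "\<dots> = (\<Sum>i<Suc n. (c i - c n) *s s i)"
    using Suc.prems(2)
    by (simp only: endo_sum[OF assms(1)] scale_sum_right sum_subtractf[symmetric])
      (intro sum.cong, auto simp: scale_left_diff_distrib)
  finally have "(\<Sum>i<n. (c i - c n) *s s i) = 0" by simp
  moreover have "f ((c i - c n) *s s i) = c i *s ((c i - c n) *s s i)" if "i < n" for i
    using that Suc.prems(2) by (simp add: endo_simps[OF assms(1)] mult.commute)
  moreover have inj: "inj_on c {..<n}"
    using Suc.prems(1) by (rule inj_on_subset) auto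
  ultimately have "(c i - c n) *s s i = 0" if "i < n" for i
    using Suc.IH[of "\<lambda>i. (c i - c n) *s s i"] that by blast
  moreover have "c i \<noteq> c n" if "i < n" for i
    using inj_onD[OF Suc.prems(1), of i n] that by auto
  ultimately have "s i = 0" if "i < n" for i
    using that by force
  then show ?case
    using Suc.prems(3,4) by (auto simp: less_Suc_eq)
qed

text \<open>
  The index is the number of steps, so the flag \<open>[0]\<close> is \<open>\<lambda>i. F (Suc i)\<close>. Starting at the zero
  space makes the bottom step of \<open>triangular\<close> the same as the others.
\<close>

definition flag :: "nat \<Rightarrow> (nat \<Rightarrow> 'b set) \<Rightarrow> bool" where
  "flag d F \<longleftrightarrow> F 0 = {0} \<and> F (Suc d) = UNIV \<and> (\<forall>n\<le>Suc d. subspace (F n)) \<and>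
     (\<forall>n\<le>d. F n \<subset> F (Suc n))"

definition triangular :: "nat \<Rightarrow> (nat \<Rightarrow> 'b set) \<Rightarrow> ('b \<Rightarrow> 'b) \<Rightarrow> (nat \<Rightarrow> 'a) \<Rightarrow> bool" where
  "triangular d F f c \<longleftrightarrow> (\<forall>i\<le>d. \<forall>v\<in>F (Suc i). f v - c i *s v \<in> F i)"

lemma triangularD: "triangular d F f c \<Longrightarrow> i \<le> d \<Longrightarrow> v \<in> F (Suc i) \<Longrightarrow> f v - c i *s v \<in> F i"
  by (simp add: triangular_def)

lemma flag_0: "flag d F \<Longrightarrow> F 0 = {0}"
  and flag_UNIV: "flag d F \<Longrightarrow> F (Suc d) = UNIV"
  and flag_subspace: "flag d F \<Longrightarrow> n \<le> Suc d \<Longrightarrow> subspace (F n)"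
  and flag_less: "flag d F \<Longrightarrow> n \<le> d \<Longrightarrow> F n \<subset> F (Suc n)"
  by (simp_all add: flag_def)

lemma flag_mono:
  assumes "flag d F" "m \<le> n" "n \<le> Suc d"
  shows "F m \<subseteq> F n"
  using assms(2,3) by (induction n rule: dec_induct) (use flag_less[OF assms(1)] in force)+

lemma triangular_cong:
  "triangular d F f c \<Longrightarrow> (\<And>i. i \<le> d \<Longrightarrow> c i = c' i) \<Longrightarrow> triangular d F f c'"
  by (simp add: triangular_def)

lemma triangular_invariant:
  assumes "flag d F" "triangular d F f c" "n \<le> Suc d" "v \<in> F n"
  shows "f v \<in> F n"
proof (cases n)
  case 0
  have "0 \<in> F (Suc 0)" using assms(1) by (simp add: flag_subspace subspace_0)
  then have "f 0 - c 0 *s 0 \<in> F 0" using triangularD[OF assms(2)] by blast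
  then show ?thesis using 0 assms(4) flag_0[OF assms(1)] by auto
next
  case (Suc i)
  have "f v - c i *s v \<in> F n"
    using triangularD[OF assms(2), of i v] flag_less[OF assms(1), of i] assms Suc by auto
  moreover have "c i *s v \<in> F n"
    using assms by (simp add: flag_subspace subspace_scale)
  ultimately have "(f v - c i *s v) + c i *s v \<in> F n"
    by (intro subspace_add[OF flag_subspace]) (use assms in auto)
  then show ?thesis by simp
qed

lemma triangular_scaled_diff:
  assumes "flag d F" "triangular d F f c" "triangular d F g e"
  shows "triangular d F (\<lambda>v. a *s f v - b *s g v) (\<lambda>i. a * c i - b * e i)"
  unfolding triangular_def
proof (intro allI impI ballI)
  fix i v assume i: "i \<le> d" "v \<in> F (Suc i)"
  have "a *s (f v - c i *s v) - b *s (g v - e i *s v) \<in> F i"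
    using subspace_diff subspace_scale flag_subspace[OF assms(1), of i] i
      triangularD[OF assms(2) i] triangularD[OF assms(3) i] by simp
  then show "a *s f v - b *s g v - (a * c i - b * e i) *s v \<in> F i"
    by (simp add: algebra_simps)
qed

text \<open>
  Triangular systems are solved by back substitution: the top coefficient is corrected first, and the
  error lies one step lower in the flag.
\<close>

lemma triangular_solve:
  assumes "endo f" "flag d F" "triangular d F f c" "n \<le> Suc d"
    and "\<And>j. j < n \<Longrightarrow> c j \<noteq> \<mu>" "y \<in> F n"
  shows "\<exists>z\<in>F n. f z - \<mu> *s z = y"
  using assms(4-)
proof (induction n arbitrary: y)
  case 0
  then show ?case using assms(1,2) by (simp add: flag_0 endo_simps)
next
  case (Suc n)
  define b where "b = inverse (c n - \<mu>)"
  have b: "b * (c n - \<mu>) = 1" using Suc.prems(2)[of n] by (simp add: b_def)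
  have "b *s (f y - c n *s y) \<in> F n"
    using subspace_scale[OF flag_subspace[OF assms(2)] triangularD[OF assms(3)]] Suc.prems by simp
  then obtain z where z: "z \<in> F n" "f z - \<mu> *s z = b *s (f y - c n *s y)"
    using Suc.IH[of "b *s (f y - c n *s y)"] Suc.prems by auto
  have "b *s y - z \<in> F (Suc n)"
    using Suc.prems z(1) flag_less[OF assms(2), of n]
    by (intro subspace_diff[OF flag_subspace[OF assms(2)]] subspace_scale[OF flag_subspace[OF assms(2)]]) auto
  moreover have "f (b *s y - z) - \<mu> *s (b *s y - z) = b *s f y - (b * \<mu>) *s y - (f z - \<mu> *s z)"
    by (simp add: endo_simps[OF assms(1)] algebra_simps)
  then have "f (b *s y - z) - \<mu> *s (b *s y - z) = (b * (c n - \<mu>)) *s y"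
    unfolding z by (simp add: algebra_simps)
  ultimately show ?case using b by auto
qed

text \<open>
  An eigenvector cannot have a leading term in a step whose diagonal entry differs from its
  eigenvalue.
\<close>

lemma triangular_eigenvector:
  assumes "flag d F" "triangular d F f c" "n \<le> Suc d" "m \<le> n"
    and "\<And>j. m \<le> j \<Longrightarrow> j < n \<Longrightarrow> c j \<noteq> \<mu>" "z \<in> F n" "f z = \<mu> *s z"
  shows "z \<in> F m"
  using assms(4,3,5-)
proof (induction n rule: dec_induct)
  case base
  then show ?case by simp
next
  case (step n)
  have "f z - c n *s z \<in> F n"
    using triangularD[OF assms(2), of n z] step.prems by simp
  then have "inverse (\<mu> - c n) *s (f z - c n *s z) \<in> F n"
    using subspace_scale[OF flag_subspace[OF assms(1)]] step by simp
  moreover have "inverse (\<mu> - c n) *s (f z - c n *s z) = (inverse (\<mu> - c n) * (\<mu> - c n)) *s z"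
    using step by (simp add: algebra_simps)
  moreover have "inverse (\<mu> - c n) * (\<mu> - c n) = 1"
    using step.prems(2)[of n] step.hyps by simp
  ultimately show ?case using step by simp
qed

lemma triangular_bij:
  assumes "endo f" "flag d F" "triangular d F f c" "\<And>j. j \<le> d \<Longrightarrow> c j \<noteq> 0"
  shows "bij f"
proof (rule bijI)
  show "surj f"
    using triangular_solve[OF assms(1-3), of "Suc d" 0] assms flag_UNIV[OF assms(2)]
    by (metis UNIV_I diff_zero le_refl less_Suc_eq_le scale_zero_left surjI)
  have "z = 0" if "f z = 0" for z
    using triangular_eigenvector[OF assms(2,3), of "Suc d" 0 0 z] assms that
    by (auto simp: flag_UNIV flag_0 less_Suc_eq_le)
  then show "inj f"
    using module_hom.inj_iff_eq_0[OF endo_module_hom[OF assms(1)]] by blast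
qed

text \<open>
  The inverse preserves every member of the flag because the equation \<open>f z = y\<close> can already be
  solved inside the member that contains \<open>y\<close>.
\<close>

lemma triangular_inv:
  assumes "endo f" "flag d F" "triangular d F f c" "\<And>j. j \<le> d \<Longrightarrow> c j \<noteq> 0"
  shows "triangular d F (inv_into UNIV f) (\<lambda>i. inverse (c i))"
proof -
  note bij = triangular_bij[OF assms]
  have inv_f: "inv_into UNIV f (f z) = z" for z using bij by (simp add: bij_is_inj inv_f_f)
  note endo_inv = endo_inv[OF assms(1) bij]
  have inv: "inv_into UNIV f y \<in> F n" if "n \<le> Suc d" "y \<in> F n" for n y
    using triangular_solve[OF assms(1-3), of n 0 y] assms that by (auto simp: inv_f)
  show ?thesis
    unfolding triangular_def
  proof (intro allI impI ballI)
    fix i v assume i: "i \<le> d" "v \<in> F (Suc i)"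
    have "inverse (c i) *s inv_into UNIV f (f v - c i *s v) \<in> F i"
      using subspace_scale[OF flag_subspace[OF assms(2)] inv[OF _ triangularD[OF assms(3)]]] i by simp
    moreover have "inverse (c i) *s inv_into UNIV f (f v - c i *s v) = inverse (c i) *s v - inv_into UNIV f v"
      using i assms by (simp add: endo_simps[OF endo_inv] inv_f scale_right_diff_distrib)
    ultimately show "inv_into UNIV f v - inverse (c i) *s v \<in> F i"
      using subspace_neg[OF flag_subspace[OF assms(2), of i], of "inverse (c i) *s v - inv_into UNIV f v"] i
      by simp
  qed
qed

lemma triangular_conjugate:
  assumes "endo H" "triangular d F f c" "\<And>v. H (g v) = f (H v)"
  shows "triangular d (\<lambda>n. {v. H v \<in> F n}) g c"
  using assms(2) by (simp add: triangular_def endo_simps[OF assms(1)] assms(3))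

lemma flag_vimage:
  assumes "endo H" "bij H" "flag d F"
  shows "flag d (\<lambda>n. {v. H v \<in> F n})"
proof -
  have "{v. H v \<in> F n} \<subset> {v. H v \<in> F (Suc n)}" if n: "n \<le> d" for n
  proof -
    obtain y where "y \<in> F (Suc n)" "y \<notin> F n" using flag_less[OF assms(3) n] by auto
    moreover obtain v where "y = H v" using assms(2) by (meson bij_pointE)
    ultimately show ?thesis using flag_less[OF assms(3) n] by auto
  qed
  moreover have "{v. H v = 0} = {0}"
    using injD[OF bij_is_inj[OF assms(2)], of _ 0] endo_zero[OF assms(1)] by auto
  ultimately show ?thesis
    using assms by (auto simp: flag_def subspace_vimage)
qed

text \<open>
  Distinct diagonal entries make a triangular map diagonalizable, and the flag can be recovered from
  it: correcting \<open>x \<in> F (Suc n)\<close> by a solution in \<open>F n\<close> of the equation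
  \<open>(f - c n) z = (f - c n) x\<close> leaves an eigenvector.
\<close>

lemma triangular_eigenspaces:
  assumes "endo f" "flag d F" "triangular d F f c" "inj_on c {..d}" "n \<le> Suc d"
  shows "(\<Sum>j<n. eigenspace scale f (c j)) = F n"
  using assms(5)
proof (induction n)
  case 0
  then show ?case using assms(2) by (simp add: flag_0 set_zero)
next
  case (Suc n)
  let ?E = "eigenspace scale f (c n)"
  have IH: "(\<Sum>j<n. eigenspace scale f (c j)) = F n" using Suc by simp
  have ne: "c j \<noteq> c n" if "j \<noteq> n" "j \<le> d" for j
    using inj_onD[OF assms(4), of j n] Suc.prems that by auto
  have "F n + ?E = F (Suc n)"
  proof (intro equalityI subsetI)
    fix x assume "x \<in> F n + ?E"
    then obtain y z where x: "x = y + z" and y: "y \<in> F n" and z: "f z = c n *s z"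
      by (auto elim!: set_plus_elim simp: eigenspace_def)
    have "z \<in> F (Suc n)"
      using triangular_eigenvector[OF assms(2,3), of "Suc d" "Suc n" "c n" z] ne z Suc.prems
      by (auto simp: flag_UNIV[OF assms(2)])
    then show "x \<in> F (Suc n)"
      unfolding x using y flag_less[OF assms(2), of n] Suc.prems
      by (intro subspace_add flag_subspace[OF assms(2)]) auto
  next
    fix x assume x: "x \<in> F (Suc n)"
    have "f x - c n *s x \<in> F n" using x Suc.prems by (simp add: triangularD[OF assms(3)])
    then obtain z where z: "z \<in> F n" "f z - c n *s z = f x - c n *s x"
      using triangular_solve[OF assms(1-3), of n "c n" "f x - c n *s x"] ne Suc.prems by auto
    then have "f (x - z) - c n *s (x - z) = 0"
      by (simp add: endo_simps[OF assms(1)] algebra_simps)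
    then have "x - z \<in> ?E" by (simp add: eigenspace_def)
    then have "z + (x - z) \<in> F n + ?E" using z(1) by (rule set_plus_intro[rotated])
    then show "x \<in> F n + ?E" by simp
  qed
  then show ?case using IH by simp
qed

lemma diagonalizableI:
  assumes "endo f" "finite I" "(\<Sum>j\<in>I. eigenspace scale f (c j)) = UNIV"
  shows "diagonalizable scale f"
proof -
  let ?E = "\<Union>j\<in>I. eigenspace scale f (c j)"
  obtain S where S: "S \<subseteq> ?E" "independent S" "?E \<subseteq> span S"
    using maximal_independent_subset by blast
  have "span ?E = UNIV"
    using set_sum_eq_span[of I "\<lambda>j. eigenspace scale f (c j)"] assms
    by (simp add: subspace_eigenspace)
  then have "span S = UNIV" using span_minimal[OF S(3)] by auto
  moreover have "\<forall>b\<in>S. \<exists>c. f b = c *s b" using S(1) by (auto simp: eigenspace_def)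
  ultimately show ?thesis unfolding diagonalizable_def using assms(1) S(2) by blast
qed

lemma sum_atMost_reverse:
  fixes f :: "nat \<Rightarrow> 'c::comm_monoid_add"
  assumes "i \<le> d"
  shows "(\<Sum>j\<in>{d-i..d}. f j) = (\<Sum>j<Suc i. f (d - j))"
  by (rule sum.reindex_bij_witness[of _ "\<lambda>j. d - j" "\<lambda>j. d - j"]) (use assms in auto)

text \<open>
  The second flag is met from the other end of the spectrum, so its diagonal is the reversed one;
  as \<open>q^(d - 2 (d - i)) = q^(2 i - d)\<close>, this is the inverse of the first diagonal.
\<close>

lemma goes_from_toI:
  assumes "endo M" "flag d F" "flag d G"
    and F: "triangular d F M (\<lambda>i. q powi (int d - 2 * int i))"
    and G: "triangular d G M (\<lambda>i. q powi (2 * int i - int d))"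
    and inj: "inj_on (\<lambda>i. q powi (int d - 2 * int i)) {..d}"
    and F': "\<And>i. i \<le> d \<Longrightarrow> F' i = F (Suc i)" and G': "\<And>i. i \<le> d \<Longrightarrow> G' i = G (Suc i)"
  shows "goes_from_to scale q d M F' G'"
proof -
  define c where "c i = q powi (int d - 2 * int i)" for i
  define E where "E i = eigenspace scale M (c i)" for i
  have c: "inj_on c {..d}" "triangular d F M c" using inj F by (simp_all add: c_def[abs_def])
  have up: "(\<Sum>j<n. E j) = F n" if "n \<le> Suc d" for n
    unfolding E_def by (rule triangular_eigenspaces) (use that assms c in auto)
  have rev: "triangular d G M (\<lambda>i. c (d - i))"
    using G by (rule triangular_cong) (simp add: c_def of_nat_diff)
  moreover have "inj_on (\<lambda>i. c (d - i)) {..d}"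
    by (rule inj_onI) (metis atMost_iff c(1) diff_diff_cancel diff_le_self inj_onD)
  ultimately have down: "(\<Sum>j<n. E (d - j)) = G n" if "n \<le> Suc d" for n
    unfolding E_def by (intro triangular_eigenspaces) (use that assms in auto)
  have "diagonalizable scale M"
    by (rule diagonalizableI[of M "{..<Suc d}" c])
      (use up[of "Suc d"] assms flag_UNIV in \<open>auto simp: E_def[abs_def]\<close>)
  moreover have "eigenvalues scale M = c ` {..d}"
  proof (intro equalityI subsetI)
    fix \<mu> assume "\<mu> \<in> eigenvalues scale M"
    then obtain v where v: "v \<noteq> 0" "M v = \<mu> *s v" by (auto simp: eigenvalues_def)
    show "\<mu> \<in> c ` {..d}"
    proof (rule ccontr)
      assume "\<mu> \<notin> c ` {..d}"
      then have "v \<in> F 0"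
        using triangular_eigenvector[OF assms(2) c(2), of "Suc d" 0 \<mu> v] v assms(2)
        by (auto simp: flag_UNIV less_Suc_eq_le)
      then show False using v assms(2) by (simp add: flag_0)
    qed
  next
    fix \<mu> assume "\<mu> \<in> c ` {..d}"
    then obtain i where i: "i \<le> d" "\<mu> = c i" by auto
    have "E i \<noteq> {0}"
    proof
      assume "E i = {0}"
      moreover have "F (Suc i) = F i + E i" using up[of i] up[of "Suc i"] i by simp
      ultimately have "F (Suc i) = F i" by (metis add.right_neutral set_zero)
      then show False using flag_less[OF assms(2) i(1)] by simp
    qed
    moreover have "0 \<in> E i" unfolding E_def using assms(1) by (intro subspace_0 subspace_eigenspace)
    ultimately obtain v where "v \<noteq> 0" "v \<in> E i" by blast
    then show "\<mu> \<in> eigenvalues scale M" using i by (auto simp: eigenvalues_def E_def eigenspace_def)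
  qed
  moreover have "(\<Sum>j\<le>i. E j) = F' i \<and> (\<Sum>j\<in>{d-i..d}. E j) = G' i" if "i \<le> d" for i
    using up[of "Suc i"] down[of "Suc i"] that F' G'
    by (simp add: sum_atMost_reverse lessThan_Suc_atMost)
  ultimately show ?thesis
    unfolding goes_from_to_def Let_def by (simp add: c_def E_def)
qed

section \<open>Decompositions and the maps attached to them\<close>

definition decomposition :: "nat \<Rightarrow> (nat \<Rightarrow> 'b set) \<Rightarrow> bool" where
  "decomposition d W \<longleftrightarrow> (\<forall>i\<le>d. subspace (W i)) \<and>
     (\<forall>v. \<exists>s. (\<forall>i\<le>d. s i \<in> W i) \<and> v = (\<Sum>i\<le>d. s i)) \<and>
     (\<forall>s. (\<forall>i\<le>d. s i \<in> W i) \<longrightarrow> (\<Sum>i\<le>d. s i) = 0 \<longrightarrow> (\<forall>i\<le>d. s i = 0))"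

text \<open>
  The components of a vector are unique, hence linear in it, so prescribing scalars on the summands
  defines exactly one endomorphism. This gives meaning to the definite descriptions behind
  \<open>decomp_map\<close> and \<open>decomp_proj\<close>.
\<close>

lemma decomposition_map:
  assumes "decomposition d W"
  shows "\<exists>!M. endo M \<and> (\<forall>i\<le>d. \<forall>w\<in>W i. M w = c i *s w)"
proof -
  have sub: "subspace (W i)" if "i \<le> d" for i using assms that by (simp add: decomposition_def)
  define s where "s v = (SOME s. (\<forall>i\<le>d. s i \<in> W i) \<and> v = (\<Sum>i\<le>d. s i))" for v
  have ex: "\<forall>v. \<exists>s. (\<forall>i\<le>d. s i \<in> W i) \<and> v = (\<Sum>i\<le>d. s i)"
    using assms unfolding decomposition_def by (elim conjE)
  have some: "(\<forall>i\<le>d. s v i \<in> W i) \<and> v = (\<Sum>i\<le>d. s v i)" for v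
    unfolding s_def by (rule someI_ex[OF ex[THEN spec]])
  then have s: "i \<le> d \<Longrightarrow> s v i \<in> W i" for v i by blast
  have s_sum: "(\<Sum>i\<le>d. s v i) = v" for v by (rule conjunct2[OF some, symmetric])
  have uniq: "s v i = r i" if r: "\<And>i. i \<le> d \<Longrightarrow> r i \<in> W i" "(\<Sum>i\<le>d. r i) = v" and i: "i \<le> d" for v r i
  proof -
    have "\<forall>i\<le>d. s v i - r i \<in> W i" using subspace_diff[OF sub] s r(1) by blast
    moreover have "(\<Sum>i\<le>d. s v i - r i) = 0" using r(2) by (simp add: sum_subtractf s_sum)
    moreover have "\<forall>s. (\<forall>i\<le>d. s i \<in> W i) \<longrightarrow> (\<Sum>i\<le>d. s i) = 0 \<longrightarrow> (\<forall>i\<le>d. s i = 0)"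
      using assms unfolding decomposition_def by (elim conjE)
    ultimately have "\<forall>i\<le>d. s v i - r i = 0"
      using spec[where x = "\<lambda>i. s v i - r i"] by blast
    then show ?thesis using i by simp
  qed
  define M where "M v = (\<Sum>i\<le>d. c i *s s v i)" for v
  have "endo M"
  proof (rule endoI)
    fix x y b
    have add_s: "s (x + y) i = s x i + s y i" if "i \<le> d" for i
    proof (rule uniq[of "\<lambda>i. s x i + s y i"])
      show "(\<Sum>i\<le>d. s x i + s y i) = x + y" by (simp only: sum.distrib s_sum)
    qed (simp_all add: that s subspace_add[OF sub])
    have "M (x + y) = (\<Sum>i\<le>d. c i *s s x i + c i *s s y i)"
      unfolding M_def by (intro sum.cong) (simp_all add: add_s scale_right_distrib)
    then show "M (x + y) = M x + M y"
      by (simp only: M_def sum.distrib)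
    have scale_s: "s (b *s x) i = b *s s x i" if "i \<le> d" for i
    proof (rule uniq[of "\<lambda>i. b *s s x i"])
      show "(\<Sum>i\<le>d. b *s s x i) = b *s x"
        by (rule trans[OF scale_sum_right[symmetric]]) (simp only: s_sum)
    qed (simp_all add: that s subspace_scale[OF sub])
    have "M (b *s x) = (\<Sum>i\<le>d. b *s c i *s s x i)"
      unfolding M_def by (rule sum.cong) (simp_all only: scale_s atMost_iff scale_left_commute)
    also have "\<dots> = b *s M x"
      unfolding M_def by (rule scale_sum_right[symmetric])
    finally show "M (b *s x) = b *s M x" .
  qed
  moreover have "M w = c i *s w" if i: "i \<le> d" "w \<in> W i" for i w
  proof -
    have "s w j = (if j = i then w else 0)" if "j \<le> d" for j
      by (rule uniq[of "\<lambda>j. if j = i then w else 0"])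
        (use i that in \<open>simp_all add: subspace_0[OF sub]\<close>)
    then have "M w = (\<Sum>j\<le>d. if j = i then c i *s w else 0)"
      unfolding M_def by (intro sum.cong) auto
    then show ?thesis using i by simp
  qed
  moreover have "M' = M" if M': "endo M'" "\<forall>i\<le>d. \<forall>w\<in>W i. M' w = c i *s w" for M'
  proof
    fix v
    have "M' v = (\<Sum>i\<le>d. M' (s v i))"
      using endo_sum[OF M'(1), of "s v" "{..d}"] by (simp only: s_sum)
    also have "\<dots> = M v" unfolding M_def by (rule sum.cong) (use M' s in auto)
    finally show "M' v = M v" .
  qed
  ultimately show ?thesis by blast
qed

lemma decomp_map:
  assumes "decomposition d W"
  shows "endo (decomp_map scale q d W)"
    and "i \<le> d \<Longrightarrow> w \<in> W i \<Longrightarrow> decomp_map scale q d W w = q powi (int d - 2 * int i) *s w"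
  using theI'[OF decomposition_map[OF assms, of "\<lambda>i. q powi (int d - 2 * int i)"]]
  unfolding decomp_map_def[symmetric] by blast+

lemma decomp_proj:
  assumes "decomposition d W" "i \<le> d"
  shows "endo (decomp_proj scale d W i)"
    and "j \<le> d \<Longrightarrow> w \<in> W j \<Longrightarrow> decomp_proj scale d W i w = (if j = i then w else 0)"
proof -
  have "(\<forall>j\<le>d. \<forall>w\<in>W j. P w = (if j = i then 1 else 0) *s w) \<longleftrightarrow>
      (\<forall>w\<in>W i. P w = w) \<and> (\<forall>j\<le>d. j \<noteq> i \<longrightarrow> (\<forall>w\<in>W j. P w = 0))" for P
    using assms(2) by auto
  then have "\<exists>!P. endo P \<and> (\<forall>w\<in>W i. P w = w) \<and> (\<forall>j\<le>d. j \<noteq> i \<longrightarrow> (\<forall>w\<in>W j. P w = 0))"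
    using decomposition_map[OF assms(1), of "\<lambda>j. if j = i then 1 else 0"] by (simp only:)
  from theI'[OF this, folded decomp_proj_def]
  have P: "endo (decomp_proj scale d W i)" "\<forall>w\<in>W i. decomp_proj scale d W i w = w"
    "\<forall>j\<le>d. j \<noteq> i \<longrightarrow> (\<forall>w\<in>W j. decomp_proj scale d W i w = 0)"
    by blast+
  show "endo (decomp_proj scale d W i)" by (rule P(1))
  show "decomp_proj scale d W i w = (if j = i then w else 0)" if "j \<le> d" "w \<in> W j"
    using P(2,3) that by (cases "j = i") auto
qed

lemma H_map_eigen:
  assumes "decomposition d W"
  shows "endo (H_map scale q d \<theta> W)"
    and "j \<le> d \<Longrightarrow> w \<in> W j \<Longrightarrow> H_map scale q d \<theta> W w = t_coeff q \<theta> j *s w"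
proof -
  show "endo (H_map scale q d \<theta> W)"
    by (rule endoI) (simp_all add: H_map_def endo_simps[OF decomp_proj(1)[OF assms]]
        scale_right_distrib sum.distrib scale_sum_right mult.commute)
  assume j: "j \<le> d" "w \<in> W j"
  have "H_map scale q d \<theta> W w = (\<Sum>i\<le>d. if j = i then t_coeff q \<theta> i *s w else 0)"
    unfolding H_map_def by (intro sum.cong) (use j decomp_proj(2)[OF assms] in auto)
  then show "H_map scale q d \<theta> W w = t_coeff q \<theta> j *s w" using j by simp
qed

section \<open>Flags of eigenspaces\<close>

lemma eigenspace_sum_eq_span:
  fixes n :: nat
  assumes "endo f"
  shows "(\<Sum>j<n. eigenspace scale f (c j)) = span (\<Union>j<n. eigenspace scale f (c j))"
  by (rule set_sum_eq_span) (simp_all add: subspace_eigenspace assms)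

lemma flag_eigenspaces:
  assumes "endo f" "inj_on c {..d}" "(\<Sum>j\<le>d. eigenspace scale f (c j)) = UNIV"
    and "\<And>j. j \<le> d \<Longrightarrow> eigenspace scale f (c j) \<noteq> {0}"
  shows "flag d (\<lambda>n. \<Sum>j<n. eigenspace scale f (c j))"
    and "triangular d (\<lambda>n. \<Sum>j<n. eigenspace scale f (c j)) f c"
proof -
  define E where "E j = eigenspace scale f (c j)" for j
  define F where "F n = (\<Sum>j<n. E j)" for n
  have E0: "0 \<in> E j" and Esub: "subspace (E j)" for j
    using assms(1) by (simp_all add: E_def subspace_eigenspace subspace_0)
  have F_span: "F n = span (\<Union>j<n. E j)" for n
    unfolding F_def E_def by (rule eigenspace_sum_eq_span[OF assms(1)])
  have Fsub: "subspace (F n)" for n by (simp add: F_span)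
  have F_Suc: "F (Suc n) = F n + E n" for n by (simp add: F_def)
  have "F n \<subset> F (Suc n)" if n: "n \<le> d" for n
  proof -
    obtain x where x: "x \<in> E n" "x \<noteq> 0" using assms(4)[OF n] E0[of n] by (auto simp: E_def)
    have "x \<notin> F n"
    proof
      assume "x \<in> F n"
      then obtain s where s: "\<forall>j<n. s j \<in> E j" "x = (\<Sum>j<n. s j)"
        by (auto simp: F_def set_sum_alt)
      define r where "r j = (if j < n then s j else - x)" for j
      have "r n = 0"
      proof (rule independent_eigenvectors[OF assms(1)])
        show "inj_on c {..<Suc n}" using assms(2) by (rule inj_on_subset) (use n in auto)
        show "f (r i) = c i *s r i" if "i < Suc n" for i
        proof (cases "i < n")
          case True then show ?thesis using s(1) by (simp add: r_def E_def eigenspace_def)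
        next
          case False
          then have "i = n" using that by simp
          moreover have "- x \<in> E n" using x(1) subspace_neg[OF Esub] by blast
          ultimately show ?thesis by (simp add: r_def E_def eigenspace_def)
        qed
        have "(\<Sum>i<n. r i) = x" unfolding s(2) by (rule sum.cong) (simp_all add: r_def)
        then show "(\<Sum>i<Suc n. r i) = 0" by (simp add: r_def)
      qed simp
      then show False using x(2) by (simp add: r_def)
    qed
    moreover have "F n \<subseteq> F (Suc n)"
      unfolding F_span by (intro span_mono UN_mono) auto
    moreover have "0 + x \<in> F (Suc n)"
      unfolding F_Suc by (rule set_plus_intro) (use Fsub x in \<open>simp_all add: subspace_0\<close>)
    ultimately show ?thesis by auto
  qed
  moreover have "F (Suc d) = UNIV"
    using assms(3) by (simp only: F_def E_def lessThan_Suc_atMost)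
  moreover have "F 0 = {0}" by (simp add: F_def set_zero)
  ultimately show "flag d (\<lambda>n. \<Sum>j<n. eigenspace scale f (c j))"
    using Fsub by (simp add: flag_def F_def E_def)
  have inv: "f y \<in> F n" if "y \<in> F n" for y n
  proof -
    have "(\<Union>j<n. E j) \<subseteq> {v. f v \<in> F n}"
    proof safe
      fix j v assume j: "j < n" "v \<in> E j"
      then have "c j *s v \<in> F n" unfolding F_span by (intro span_scale span_base) auto
      then show "f v \<in> F n" using j by (simp add: E_def eigenspace_def)
    qed
    then have "F n \<subseteq> {v. f v \<in> F n}"
      unfolding F_span[of n] by (rule span_minimal) (use subspace_vimage[OF assms(1) Fsub] F_span in auto)
    then show ?thesis using that by auto
  qed
  show "triangular d (\<lambda>n. \<Sum>j<n. eigenspace scale f (c j)) f c"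
    unfolding triangular_def E_def[symmetric] F_def[symmetric]
  proof (intro allI impI ballI)
    fix i v assume "i \<le> d" "v \<in> F (Suc i)"
    then obtain y z where v: "v = y + z" "y \<in> F i" "z \<in> E i"
      unfolding F_Suc by (auto elim: set_plus_elim)
    have "f v - c i *s v = f y - c i *s y"
      using v(3) by (simp add: v(1) endo_simps[OF assms(1)] E_def eigenspace_def scale_right_distrib)
    also have "\<dots> \<in> F i"
      using inv[OF v(2)] v(2) by (intro subspace_diff[OF Fsub] subspace_scale[OF Fsub])
    finally show "f v - c i *s v \<in> F i" .
  qed
qed

lemma decomposition_eigenspaces:
  assumes "endo f" "inj_on c {..d}" "(\<Sum>j\<le>d. eigenspace scale f (c j)) = UNIV"
  shows "decomposition d (\<lambda>j. eigenspace scale f (c j))"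
  unfolding decomposition_def
proof (intro conjI allI impI)
  fix v
  have "v \<in> (\<Sum>j\<le>d. eigenspace scale f (c j))" using assms(3) by simp
  then show "\<exists>s. (\<forall>i\<le>d. s i \<in> eigenspace scale f (c i)) \<and> v = (\<Sum>i\<le>d. s i)"
    by (auto simp: set_sum_alt)
next
  fix s i assume s: "\<forall>i\<le>d. s i \<in> eigenspace scale f (c i)" "(\<Sum>i\<le>d. s i) = 0" "i \<le> d"
  show "s i = 0"
    by (rule independent_eigenvectors[OF assms(1), of c "Suc d"])
      (use assms(2) s in \<open>simp_all add: lessThan_Suc_atMost eigenspace_def less_Suc_eq_le\<close>)
qed (simp add: subspace_eigenspace assms(1))

text \<open>
  The half of tridiagonality that matters for flags: no index grows by more than one.
\<close>

lemma tridiagonal_raises: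
  fixes f g :: "'b \<Rightarrow> 'b" and c :: "nat \<Rightarrow> 'a"
  defines "E \<equiv> \<lambda>j. eigenspace scale f (c j)"
  assumes "endo f" "endo g"
    and tri: "\<And>i v. i \<le> d \<Longrightarrow> v \<in> E i \<Longrightarrow> g v \<in> (\<Sum>j\<in>{j. j \<le> d \<and> j \<le> i + 1 \<and> i \<le> j + 1}. E j)"
    and n: "n \<le> d" and v: "v \<in> (\<Sum>j<n. E j)"
  shows "g v \<in> (\<Sum>j<Suc n. E j)"
proof -
  have span: "(\<Sum>j\<in>I. E j) = span (\<Union>j\<in>I. E j)" if "finite I" for I
    by (rule set_sum_eq_span) (simp_all add: that E_def subspace_eigenspace assms(2))
  have "(\<Union>j<n. E j) \<subseteq> {v. g v \<in> span (\<Union>j<Suc n. E j)}"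
  proof safe
    fix i v assume i: "i < n" "v \<in> E i"
    then have "g v \<in> span (\<Union>j\<in>{j. j \<le> d \<and> j \<le> i + 1 \<and> i \<le> j + 1}. E j)"
      using tri[of i v] n by (simp add: span)
    also have "\<dots> \<subseteq> span (\<Union>j<Suc n. E j)" by (intro span_mono UN_mono) (use i in auto)
    finally show "g v \<in> span (\<Union>j<Suc n. E j)" .
  qed
  then have "span (\<Union>j<n. E j) \<subseteq> {v. g v \<in> span (\<Union>j<Suc n. E j)}"
    by (rule span_minimal) (rule subspace_vimage[OF assms(3) subspace_span])
  then show ?thesis using v by (auto simp only: span finite_lessThan)
qed

end

section \<open>Tridiagonal systems and the split decomposition\<close>

text \<open>
  Only the pair of maps with its two eigenvalue orderings is kept here. This description is stable
  under reversing either ordering, which is how one theorem about \<open>B\<close> yields all four maps.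
\<close>

locale tridiagonal_system = scalar_space scale
  for scale :: "'a::field \<Rightarrow> 'b::ab_group_add \<Rightarrow> 'b" (infixr \<open>*s\<close> 75) +
  fixes A Astar :: "'b \<Rightarrow> 'b" and d :: nat and \<theta> \<theta>star :: "nat \<Rightarrow> 'a"
  assumes endo_A: "endo A" and endo_Astar: "endo Astar"
    and inj_\<theta>: "inj_on \<theta> {..d}" and inj_\<theta>star: "inj_on \<theta>star {..d}"
    and V_sum: "(\<Sum>j\<le>d. eigenspace scale A (\<theta> j)) = UNIV"
    and Vstar_sum: "(\<Sum>j\<le>d. eigenspace scale Astar (\<theta>star j)) = UNIV"
    and V_nonzero: "j \<le> d \<Longrightarrow> eigenspace scale A (\<theta> j) \<noteq> {0}"
    and Vstar_nonzero: "j \<le> d \<Longrightarrow> eigenspace scale Astar (\<theta>star j) \<noteq> {0}"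
    and Astar_tridiagonal: "i \<le> d \<Longrightarrow> v \<in> eigenspace scale A (\<theta> i) \<Longrightarrow>
      Astar v \<in> (\<Sum>j\<in>{j. j \<le> d \<and> j \<le> i + 1 \<and> i \<le> j + 1}. eigenspace scale A (\<theta> j))"
    and A_tridiagonal: "i \<le> d \<Longrightarrow> v \<in> eigenspace scale Astar (\<theta>star i) \<Longrightarrow>
      A v \<in> (\<Sum>j\<in>{j. j \<le> d \<and> j \<le> i + 1 \<and> i \<le> j + 1}. eigenspace scale Astar (\<theta>star j))"
    and irreducible: "subspace S \<Longrightarrow> A ` S \<subseteq> S \<Longrightarrow> Astar ` S \<subseteq> S \<Longrightarrow> S = {0} \<or> S = UNIV"
begin

definition U :: "nat \<Rightarrow> 'b set" where
  "U n = (\<Sum>j<n. eigenspace scale A (\<theta> j))"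

definition Ustar :: "nat \<Rightarrow> 'b set" where
  "Ustar n = (\<Sum>j<n. eigenspace scale Astar (\<theta>star j))"

lemma flag_U: "flag d U" and triangular_A: "triangular d U A \<theta>"
  using flag_eigenspaces[OF endo_A inj_\<theta> V_sum V_nonzero] by (simp_all add: U_def[abs_def])

lemma flag_Ustar: "flag d Ustar" and triangular_Astar: "triangular d Ustar Astar \<theta>star"
  using flag_eigenspaces[OF endo_Astar inj_\<theta>star Vstar_sum Vstar_nonzero]
  by (simp_all add: Ustar_def[abs_def])

lemma A_raises: "n \<le> d \<Longrightarrow> v \<in> Ustar n \<Longrightarrow> A v \<in> Ustar (Suc n)"
  unfolding Ustar_def by (rule tridiagonal_raises[OF endo_Astar endo_A A_tridiagonal])

lemma Astar_raises: "n \<le> d \<Longrightarrow> v \<in> U n \<Longrightarrow> Astar v \<in> U (Suc n)"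
  unfolding U_def by (rule tridiagonal_raises[OF endo_A endo_Astar Astar_tridiagonal])

lemmas subspace_U = flag_subspace[OF flag_U] and subspace_Ustar = flag_subspace[OF flag_Ustar]

text \<open>
  On \<open>V*_0 + ... + V*_(m-1)\<close> intersected with \<open>V_0 + ... + V_(n-1)\<close>, subtracting the top
  eigenvalue from \<open>A\<close> lowers \<open>n\<close> and raises \<open>m\<close> by one, and \<open>A*\<close> does the opposite.
  So the span over a fixed sum \<open>m + n\<close> is a candidate for an invariant subspace.
\<close>

definition antidiagonal :: "nat \<Rightarrow> 'b set" where
  "antidiagonal r = span (\<Union>m\<le>r. Ustar m \<inter> U (r - m))"

lemma antidiagonal_base: "m + n = r \<Longrightarrow> w \<in> Ustar m \<Longrightarrow> w \<in> U n \<Longrightarrow> w \<in> antidiagonal r"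
  unfolding antidiagonal_def by (rule span_base) auto

lemma antidiagonal_invariant:
  assumes r: "r \<le> d + 2"
  shows "A ` antidiagonal r \<subseteq> antidiagonal r" "Astar ` antidiagonal r \<subseteq> antidiagonal r"
proof -
  let ?T = "antidiagonal r"
  have sub: "subspace ?T" by (simp add: antidiagonal_def)
  have gen: "A w \<in> ?T \<and> Astar w \<in> ?T" if w: "w \<in> Ustar m" "w \<in> U n" and mn: "m + n = r" for w m n
  proof (cases "m = 0 \<or> n = 0")
    case True
    then have "w = 0" using w flag_0[OF flag_U] flag_0[OF flag_Ustar] by auto
    then show ?thesis using sub by (simp add: endo_zero endo_A endo_Astar subspace_0)
  next
    case False
    then obtain m' n' where m: "m = Suc m'" and n: "n = Suc n'" by (meson nat.exhaust)
    have bounds: "m' \<le> d" "n' \<le> d" using m n mn r by auto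
    have wT: "w \<in> ?T" using antidiagonal_base[OF mn w] .
    \<comment> \<open>For n' = 0 the remainder lies in U 0, so it vanishes; otherwise Ustar has a member after m.\<close>
    have "A w - \<theta> n' *s w \<in> ?T"
    proof (cases "n' = 0")
      case True
      have "A w - \<theta> n' *s w \<in> U n'" using triangularD[OF triangular_A bounds(2)] w n by simp
      then have "A w - \<theta> n' *s w = 0" using True flag_0[OF flag_U] by simp
      then show ?thesis using sub by (simp add: subspace_0)
    next
      case False
      then have md: "m \<le> d" using m n mn r by simp
      have "A w - \<theta> n' *s w \<in> U n'" using triangularD[OF triangular_A bounds(2)] w n by simp
      moreover have "A w - \<theta> n' *s w \<in> Ustar (Suc m)"
        using A_raises[OF md w(1)] w(1) flag_less[OF flag_Ustar md] md
        by (intro subspace_diff[OF subspace_Ustar] subspace_scale[OF subspace_Ustar]) auto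
      ultimately show ?thesis using antidiagonal_base[of "Suc m" n' r] mn n by simp
    qed
    then have "(A w - \<theta> n' *s w) + \<theta> n' *s w \<in> ?T"
      using wT by (intro subspace_add[OF sub] subspace_scale[OF sub])
    moreover have "Astar w - \<theta>star m' *s w \<in> ?T"
    proof (cases "m' = 0")
      case True
      have "Astar w - \<theta>star m' *s w \<in> Ustar m'"
        using triangularD[OF triangular_Astar bounds(1)] w m by simp
      then have "Astar w - \<theta>star m' *s w = 0" using True flag_0[OF flag_Ustar] by simp
      then show ?thesis using sub by (simp add: subspace_0)
    next
      case False
      then have nd: "n \<le> d" using m n mn r by simp
      have "Astar w - \<theta>star m' *s w \<in> Ustar m'"
        using triangularD[OF triangular_Astar bounds(1)] w m by simp
      moreover have "Astar w - \<theta>star m' *s w \<in> U (Suc n)"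
        using Astar_raises[OF nd w(2)] w(2) flag_less[OF flag_U nd] nd
        by (intro subspace_diff[OF subspace_U] subspace_scale[OF subspace_U]) auto
      ultimately show ?thesis using antidiagonal_base[of m' "Suc n" r] mn m by simp
    qed
    then have "(Astar w - \<theta>star m' *s w) + \<theta>star m' *s w \<in> ?T"
      using wT by (intro subspace_add[OF sub] subspace_scale[OF sub])
    ultimately show ?thesis by simp
  qed
  have "(\<Union>m\<le>r. Ustar m \<inter> U (r - m)) \<subseteq> {v. A v \<in> ?T} \<inter> {v. Astar v \<in> ?T}"
    using gen by fastforce
  then have "?T \<subseteq> {v. A v \<in> ?T} \<inter> {v. Astar v \<in> ?T}"
    unfolding antidiagonal_def[of r]
    by (rule span_minimal)
      (intro subspace_inter subspace_vimage endo_A endo_Astar subspace_span)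
  then show "A ` ?T \<subseteq> ?T" "Astar ` ?T \<subseteq> ?T" by auto
qed

lemma antidiagonal_cases: "r \<le> d + 2 \<Longrightarrow> antidiagonal r = {0} \<or> antidiagonal r = UNIV"
  by (rule irreducible) (simp_all add: antidiagonal_invariant, simp add: antidiagonal_def)

text \<open>
  For index sum \<open>d + 1\<close> every intersection lies in the proper subspace \<open>U d\<close>, so irreducibility
  forces all of them to vanish. In other words, the two flags are opposite to each other.
\<close>

lemma flags_opposite:
  assumes "m + n \<le> d + 1" "w \<in> Ustar m" "w \<in> U n"
  shows "w = 0"
proof -
  have "(\<Union>m\<le>d+1. Ustar m \<inter> U (d + 1 - m)) \<subseteq> U d"
  proof safe
    fix m w assume m: "m \<le> d + 1" "w \<in> Ustar m" "w \<in> U (d + 1 - m)"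
    show "w \<in> U d"
    proof (cases "m = 0")
      case True
      then have "w = 0" using m flag_0[OF flag_Ustar] by simp
      then show ?thesis by (simp add: subspace_0 subspace_U)
    next
      case False
      then have "U (d + 1 - m) \<subseteq> U d" by (intro flag_mono[OF flag_U]) auto
      then show ?thesis using m(3) by blast
    qed
  qed
  then have "antidiagonal (d + 1) \<subseteq> U d"
    unfolding antidiagonal_def by (rule span_minimal) (simp add: subspace_U)
  then have "antidiagonal (d + 1) = {0}"
    using antidiagonal_cases[of "d + 1"] flag_less[OF flag_U, of d] by auto
  moreover have "w \<in> U (d + 1 - m)"
  proof (rule subsetD[OF flag_mono[OF flag_U] assms(3)])
    show "n \<le> d + 1 - m" using assms(1) by linarith
  qed simp
  then have "w \<in> antidiagonal (d + 1)"
    using antidiagonal_base[of m "d + 1 - m"] assms by simp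
  ultimately show ?thesis by simp
qed

definition W :: "nat \<Rightarrow> 'b set" where
  "W i = Ustar (Suc i) \<inter> U (Suc (d - i))"

lemma subspace_W: "i \<le> d \<Longrightarrow> subspace (W i)"
  by (simp add: W_def subspace_inter subspace_U subspace_Ustar)

lemma W_Ustar: "i < n \<Longrightarrow> n \<le> Suc d \<Longrightarrow> w \<in> W i \<Longrightarrow> w \<in> Ustar n"
  using flag_mono[OF flag_Ustar, of "Suc i" n] by (auto simp: W_def)

lemma W_U: "d < i + n \<Longrightarrow> i \<le> d \<Longrightarrow> n \<le> Suc d \<Longrightarrow> w \<in> W i \<Longrightarrow> w \<in> U n"
  using subsetD[OF flag_mono[OF flag_U, of "Suc (d - i)" n], of w] by (simp add: W_def)

text \<open>
  For index sum \<open>d + 2\<close> the nonzero space \<open>V*_0\<close> is one of the intersections, so irreducibility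
  forces them to span.
\<close>

lemma W_span: "(\<Sum>i\<le>d. W i) = UNIV"
proof -
  have "Ustar (Suc 0) \<subseteq> antidiagonal (d + 2)"
  proof
    fix w assume "w \<in> Ustar (Suc 0)"
    then show "w \<in> antidiagonal (d + 2)"
      by (rule antidiagonal_base[of _ "Suc d", rotated]) (simp_all only: flag_UNIV[OF flag_U], simp_all)
  qed
  moreover have "{0} \<subset> Ustar (Suc 0)"
    using flag_less[OF flag_Ustar le0] flag_0[OF flag_Ustar] by metis
  ultimately have "antidiagonal (d + 2) = UNIV"
    using antidiagonal_cases[of "d + 2", OF le_refl] by blast
  moreover have "(\<Union>m\<le>d+2. Ustar m \<inter> U (d + 2 - m)) \<subseteq> span (\<Union>i\<le>d. W i)"
  proof safe
    fix m w assume m: "m \<le> d + 2" "w \<in> Ustar m" "w \<in> U (d + 2 - m)"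
    show "w \<in> span (\<Union>i\<le>d. W i)"
    proof (cases "m = 0 \<or> m = d + 2")
      case True
      then have "w \<in> Ustar 0 \<or> w \<in> U 0" using m(2,3) by (metis diff_self_eq_0)
      then have "w = 0" by (simp add: flag_0[OF flag_U] flag_0[OF flag_Ustar])
      then show ?thesis by (simp only: span_zero)
    next
      case False
      define i where "i = m - 1"
      have i: "m = Suc i" "i \<le> d" "d + 2 - m = Suc (d - i)"
        unfolding i_def using m(1) False by linarith+
      then have "w \<in> W i" using m(2,3) by (simp only: W_def Int_iff)
      then show ?thesis using i by (intro span_base) auto
    qed
  qed
  then have "antidiagonal (d + 2) \<subseteq> span (\<Union>i\<le>d. W i)"
    unfolding antidiagonal_def by (rule span_minimal) simp
  ultimately show ?thesis
    using set_sum_eq_span[of "{..d}" W] by (simp add: subspace_W top_unique)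
qed

lemma W_independent:
  assumes s: "\<forall>i\<le>d. s i \<in> W i" and sum: "(\<Sum>i\<le>d. s i) = 0" and "i \<le> d"
  shows "s i = 0"
  using assms(3)
proof (induction i rule: less_induct)
  case (less i)
  have split: "{..d} = insert i ({..<i} \<union> {i<..d})" using less.prems by auto
  have "(\<Sum>j\<le>d. s j) = s i + ((\<Sum>j<i. s j) + (\<Sum>j\<in>{i<..d}. s j))"
    unfolding split by (subst sum.insert, simp, simp, subst sum.union_disjoint) auto
  moreover have "(\<Sum>j<i. s j) = 0" by (rule sum.neutral) (use less in auto)
  ultimately have si: "s i = - (\<Sum>j\<in>{i<..d}. s j)" using sum by (simp add: eq_neg_iff_add_eq_0)
  have "(\<Sum>j\<in>{i<..d}. s j) \<in> U (d - i)"
    by (rule subspace_sum[OF subspace_U], simp, rule W_U) (use s less.prems in auto)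
  then have "s i \<in> U (d - i)"
    unfolding si by (rule subspace_neg[OF subspace_U, rotated]) simp
  moreover have "s i \<in> Ustar (Suc i)" using s less.prems by (simp add: W_def)
  ultimately show ?case using flags_opposite[of "Suc i" "d - i"] less.prems by simp
qed

lemma decomposition_W: "decomposition d W"
  unfolding decomposition_def
proof (intro conjI allI impI)
  fix v
  have "v \<in> (\<Sum>i\<le>d. W i)" by (simp add: W_span)
  then show "\<exists>s. (\<forall>i\<le>d. s i \<in> W i) \<and> v = (\<Sum>i\<le>d. s i)" by (auto simp: set_sum_alt)
qed (use subspace_W W_independent in blast)+

text \<open>
  The part of a vector of \<open>Ustar n\<close> with components of index at least \<open>n\<close> lies in opposite
  members of the two flags, so it vanishes. With its analogue for \<open>U\<close> this says that the partial
  sums of the split decomposition are the members of the two flags.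
\<close>

lemma W_components_Ustar:
  assumes s: "\<forall>i\<le>d. s i \<in> W i" and v: "(\<Sum>i\<le>d. s i) \<in> Ustar n" and n: "n \<le> i" "i \<le> d"
  shows "s i = 0"
proof -
  define r where "r j = (if n \<le> j then s j else 0)" for j
  have "(\<Sum>j\<le>d. r j) + (\<Sum>j<n. s j) = (\<Sum>j\<le>d. s j)"
  proof -
    have split: "{..d} = {..<n} \<union> {n..d}" using n by auto
    have "(\<Sum>j\<le>d. r j) = (\<Sum>j\<in>{n..d}. s j)"
      unfolding r_def by (rule sum.mono_neutral_cong_right) auto
    moreover have "(\<Sum>j\<le>d. s j) = (\<Sum>j<n. s j) + (\<Sum>j\<in>{n..d}. s j)"
      unfolding split by (rule sum.union_disjoint) auto
    ultimately show ?thesis by simp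
  qed
  then have eq: "(\<Sum>j\<le>d. r j) = (\<Sum>j\<le>d. s j) - (\<Sum>j<n. s j)" by (simp add: algebra_simps)
  have "(\<Sum>j<n. s j) \<in> Ustar n"
    by (rule subspace_sum[OF subspace_Ustar], use n in simp, rule W_Ustar) (use s n in auto)
  then have "(\<Sum>j\<le>d. r j) \<in> Ustar n"
    unfolding eq using v n by (intro subspace_diff[OF subspace_Ustar]) auto
  moreover have "(\<Sum>j\<le>d. r j) \<in> U (Suc (d - n))"
  proof (rule subspace_sum[OF subspace_U])
    fix j assume "j \<in> {..d}"
    then show "r j \<in> U (Suc (d - n))"
      using W_U[of j "Suc (d - n)" "s j"] s subspace_0[OF subspace_U, of "Suc (d - n)"]
      by (auto simp: r_def)
  qed simp
  ultimately have "(\<Sum>j\<le>d. r j) = 0" using flags_opposite[of n "Suc (d - n)"] n by simp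
  moreover have "\<forall>j\<le>d. r j \<in> W j" using s subspace_0[OF subspace_W] by (simp add: r_def)
  ultimately have "r i = 0" using W_independent n by blast
  then show ?thesis using n by (simp add: r_def)
qed

lemma W_components_U:
  assumes s: "\<forall>i\<le>d. s i \<in> W i" and v: "(\<Sum>i\<le>d. s i) \<in> U n" and n: "i + n \<le> d"
  shows "s i = 0"
proof -
  define k where "k = Suc (d - n)"
  have k: "i < k" "k \<le> Suc d" "k + n = Suc d" using n by (auto simp: k_def)
  define r where "r j = (if j < k then s j else 0)" for j
  have "(\<Sum>j\<le>d. r j) + (\<Sum>j\<in>{k..d}. s j) = (\<Sum>j\<le>d. s j)"
  proof -
    have split: "{..d} = {..<k} \<union> {k..d}" using k by auto
    have "(\<Sum>j\<le>d. r j) = (\<Sum>j<k. s j)"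
      unfolding r_def by (rule sum.mono_neutral_cong_right) (use k in auto)
    moreover have "(\<Sum>j\<le>d. s j) = (\<Sum>j<k. s j) + (\<Sum>j\<in>{k..d}. s j)"
      unfolding split by (rule sum.union_disjoint) auto
    ultimately show ?thesis by simp
  qed
  then have eq: "(\<Sum>j\<le>d. r j) = (\<Sum>j\<le>d. s j) - (\<Sum>j\<in>{k..d}. s j)" by (simp add: algebra_simps)
  have nd: "n \<le> Suc d" using n by simp
  have "(\<Sum>j\<in>{k..d}. s j) \<in> U n"
    by (rule subspace_sum[OF subspace_U[OF nd]], rule W_U) (use s k nd in auto)
  then have "(\<Sum>j\<le>d. r j) \<in> U n"
    unfolding eq using v nd by (intro subspace_diff[OF subspace_U]) auto
  moreover have "(\<Sum>j\<le>d. r j) \<in> Ustar k"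
  proof (rule subspace_sum[OF subspace_Ustar[OF k(2)]])
    fix j assume "j \<in> {..d}"
    then show "r j \<in> Ustar k"
      using W_Ustar[of j k "s j"] s k subspace_0[OF subspace_Ustar[OF k(2)]]
      by (auto simp: r_def)
  qed
  ultimately have "(\<Sum>j\<le>d. r j) = 0" using flags_opposite[of k n] k by simp
  moreover have "\<forall>j\<le>d. r j \<in> W j" using s subspace_0[OF subspace_W] by (simp add: r_def)
  ultimately have "r i = 0" using W_independent n by (meson le_trans le_add1)
  then show ?thesis using k by (simp add: r_def)
qed

text \<open>
  In \<open>U\<close> the summands come in reversed order, and so does the diagonal.
\<close>

lemma split_map_triangular:
  assumes M: "endo M" "\<And>i w. i \<le> d \<Longrightarrow> w \<in> W i \<Longrightarrow> M w = c i *s w"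
  shows "triangular d Ustar M c" and "triangular d U M (\<lambda>i. c (d - i))"
proof -
  have ex: "\<exists>s. (\<forall>i\<le>d. s i \<in> W i) \<and> v = (\<Sum>i\<le>d. s i)" for v
    using decomposition_W by (simp add: decomposition_def)
  have act: "M (\<Sum>j\<le>d. s j) - b *s (\<Sum>j\<le>d. s j) = (\<Sum>j\<le>d. (c j - b) *s s j)"
    if "\<forall>i\<le>d. s i \<in> W i" for s b
    unfolding endo_sum[OF M(1)] scale_sum_right sum_subtractf[symmetric]
    by (rule sum.cong) (use that M(2) in \<open>simp_all add: scale_left_diff_distrib\<close>)
  show "triangular d Ustar M c"
    unfolding triangular_def
  proof (intro allI impI ballI)
    fix i v assume i: "i \<le> d" "v \<in> Ustar (Suc i)"
    obtain s where s: "\<forall>i\<le>d. s i \<in> W i" and v: "v = (\<Sum>i\<le>d. s i)" using ex by blast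
    have "(c j - c i) *s s j \<in> Ustar i" if "j \<le> d" for j
    proof (cases "j < i")
      case True
      then have "s j \<in> Ustar i" using W_Ustar[of j i "s j"] s i that by simp
      then show ?thesis using i by (intro subspace_scale[OF subspace_Ustar]) auto
    next
      case False
      then have "j = i \<or> s j = 0"
        using W_components_Ustar[OF s, of "Suc i" j] i(2) False that unfolding v by linarith
      then have zero: "(c j - c i) *s s j = 0" by auto
      show ?thesis unfolding zero by (rule subspace_0[OF subspace_Ustar]) (use i in simp)
    qed
    then show "M v - c i *s v \<in> Ustar i"
      unfolding v act[OF s] using i by (intro subspace_sum[OF subspace_Ustar]) auto
  qed
  show "triangular d U M (\<lambda>i. c (d - i))"
    unfolding triangular_def
  proof (intro allI impI ballI)
    fix i v assume i: "i \<le> d" "v \<in> U (Suc i)"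
    obtain s where s: "\<forall>i\<le>d. s i \<in> W i" and v: "v = (\<Sum>i\<le>d. s i)" using ex by blast
    have "(c j - c (d - i)) *s s j \<in> U i" if "j \<le> d" for j
    proof (cases "d < j + i")
      case True
      then have "s j \<in> U i" using W_U[of j i "s j"] s i that by simp
      then show ?thesis using i by (intro subspace_scale[OF subspace_U]) auto
    next
      case False
      then have "j = d - i \<or> s j = 0"
        using W_components_U[OF s, of "Suc i" j] i that unfolding v by linarith
      then have zero: "(c j - c (d - i)) *s s j = 0" by auto
      show ?thesis unfolding zero by (rule subspace_0[OF subspace_U]) (use i in simp)
    qed
    then show "M v - c (d - i) *s v \<in> U i"
      unfolding v act[OF s] using i by (intro subspace_sum[OF subspace_U]) auto
  qed
qed

text \<open>
  Subtracting the top eigenvalue lowers the member of \<open>U\<close> by one step, while tridiagonality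
  raises the member of \<open>Ustar\<close> by at most one step.
\<close>

lemma A_W:
  assumes i: "i \<le> d" and w: "w \<in> W i"
  shows "i < d \<Longrightarrow> A w - \<theta> (d - i) *s w \<in> W (Suc i)" and "i = d \<Longrightarrow> A w - \<theta> (d - i) *s w = 0"
proof -
  have U: "A w - \<theta> (d - i) *s w \<in> U (d - i)"
    using triangularD[OF triangular_A, of "d - i" w] w by (simp add: W_def)
  then show "i = d \<Longrightarrow> A w - \<theta> (d - i) *s w = 0" using flag_0[OF flag_U] by simp
  assume "i < d"
  then have id: "Suc i \<le> d" by simp
  have w': "w \<in> Ustar (Suc i)" using w by (simp add: W_def)
  have "A w - \<theta> (d - i) *s w \<in> Ustar (Suc (Suc i))"
    using A_raises[OF id w'] w' flag_less[OF flag_Ustar id] id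
    by (intro subspace_diff[OF subspace_Ustar] subspace_scale[OF subspace_Ustar]) auto
  then show "A w - \<theta> (d - i) *s w \<in> W (Suc i)" using U id by (simp add: W_def Suc_diff_Suc)
qed

end

section \<open>The eigenvalue sequence\<close>

lemma power_int_inject_not_root:
  fixes q :: "'a::field"
  assumes "q \<noteq> 0" "\<forall>n::nat. n \<ge> 1 \<longrightarrow> q ^ n \<noteq> 1" "q powi m = q powi n"
  shows "m = n"
proof (rule ccontr)
  assume "m \<noteq> n"
  have "q powi (m - n) = 1" "q powi (n - m) = 1"
    using assms(1,3) by (simp_all add: power_int_diff)
  then have "q powi int (nat \<bar>m - n\<bar>) = 1" by (cases "m \<ge> n") (simp_all add: abs_if)
  then have "q ^ nat \<bar>m - n\<bar> = 1" by (simp only: power_int_of_nat)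
  moreover have "nat \<bar>m - n\<bar> \<ge> 1" using \<open>m \<noteq> n\<close> by simp
  ultimately show False using assms(2) by blast
qed

locale q_racah_sequence =
  fixes q a :: "'a::field" and d :: nat and \<theta> :: "nat \<Rightarrow> 'a"
  assumes q_nonzero: "q \<noteq> 0" and q_not_root: "\<forall>n::nat. n \<ge> 1 \<longrightarrow> q ^ n \<noteq> 1"
    and a_nonzero: "a \<noteq> 0"
    and distinct_\<theta>: "inj_on \<theta> {..d}"
    and \<theta>_form: "i \<le> d \<Longrightarrow>
      \<theta> i = a * q powi (int d - 2 * int i) + inverse a * q powi (2 * int i - int d)"
begin

definition Q :: "nat \<Rightarrow> 'a" where
  "Q i = q powi (int d - 2 * int i)"

lemma Q_nonzero: "Q i \<noteq> 0"
  using q_nonzero by (simp add: Q_def)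

lemma inverse_Q: "inverse (Q i) = q powi (2 * int i - int d)"
  by (simp add: Q_def power_int_minus[symmetric])

lemma Q_Suc: "Q i = q\<^sup>2 * Q (Suc i)"
proof -
  have "Q i = q powi (2 + (int d - 2 * int (Suc i)))" by (simp add: Q_def)
  also have "\<dots> = q\<^sup>2 * Q (Suc i)"
    unfolding Q_def by (subst power_int_add) (use q_nonzero in simp_all)
  finally show ?thesis .
qed

lemma Q_reverse: "i \<le> d \<Longrightarrow> Q (d - i) = inverse (Q i)"
  unfolding inverse_Q by (simp add: Q_def of_nat_diff)

lemma Q_inject: "Q i = Q j \<longleftrightarrow> i = j"
  using power_int_inject_not_root[OF q_nonzero q_not_root] unfolding Q_def by fastforce

lemma \<theta>_Q: "i \<le> d \<Longrightarrow> \<theta> i = a * Q i + inverse a * inverse (Q i)"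
  unfolding inverse_Q by (simp add: \<theta>_form Q_def)

text \<open>
  The difference \<open>\<theta> i - \<theta> j\<close> has the factor \<open>a - a^-1 / (Q i * Q j)\<close>, so distinct
  eigenvalues exclude these values of \<open>a^2\<close>.
\<close>

lemma Q_product:
  assumes "i \<le> d" "j \<le> d" "i \<noteq> j"
  shows "a\<^sup>2 * (Q i * Q j) \<noteq> 1"
proof
  assume h: "a\<^sup>2 * (Q i * Q j) = 1"
  have "a * Q i = inverse a * inverse (Q j)" "a * Q j = inverse a * inverse (Q i)"
    using h Q_nonzero[of i] Q_nonzero[of j] a_nonzero by (simp_all add: field_simps power2_eq_square)
  then have "\<theta> i = \<theta> j" using assms by (simp add: \<theta>_Q)
  then show False using inj_onD[OF distinct_\<theta>] assms by simp
qed

text \<open>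
  In terms of \<open>z = q * Q (i + 1)\<close>, halfway between the two powers of \<open>q\<close>, the factors on the
  left are \<open>(q - q^-1) (a z - a^-1 z^-1)\<close> and \<open>(q^2 - q^-2) a z\<close>.
\<close>

lemma adjacent_difference_product:
  assumes "i < d"
  shows "(\<theta> i - \<theta> (Suc i)) * (q * \<theta> i - inverse q * \<theta> (Suc i)) =
    (a\<^sup>2 * (Q i * Q (Suc i)) - 1) * ((q - inverse q) * (q\<^sup>2 - inverse (q\<^sup>2)))"
proof -
  define z where "z = q * Q (Suc i)"
  have identity: "(b * (p * z) + b' * (p' * z') - (b * (p' * z) + b' * (p * z'))) *
      (p * (b * (p * z) + b' * (p' * z')) - p' * (b * (p' * z) + b' * (p * z'))) =
      (b\<^sup>2 * z\<^sup>2 - (b * b') * (z * z')) * ((p - p') * (p\<^sup>2 - p'\<^sup>2))" for b b' p p' z z' :: 'a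
    by (simp add: algebra_simps power2_eq_square)
  have "z \<noteq> 0" using q_nonzero Q_nonzero[of "Suc i"] by (simp add: z_def)
  then have zz: "z * inverse z = 1" "a * inverse a = 1"
    using a_nonzero by simp_all
  have QS: "Q (Suc i) = inverse q * z" using q_nonzero by (simp add: z_def)
  have Qi: "Q i = q * z" using Q_Suc[of i] by (simp add: z_def power2_eq_square)
  have \<theta>: "\<theta> i = a * (q * z) + inverse a * (inverse q * inverse z)"
    "\<theta> (Suc i) = a * (inverse q * z) + inverse a * (q * inverse z)"
    using assms \<theta>_Q[of i] \<theta>_Q[of "Suc i"] by (simp_all add: Qi QS)
  have "Q i * Q (Suc i) = z\<^sup>2" using q_nonzero by (simp add: Qi QS power2_eq_square)
  then show ?thesis
    unfolding \<theta> identity zz power_inverse by simp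
qed

lemma q_differences_nonzero: "q - inverse q \<noteq> 0" "q\<^sup>2 - inverse (q\<^sup>2) \<noteq> 0"
proof -
  have "q ^ 2 \<noteq> 1" "q ^ 4 \<noteq> 1" using q_not_root by simp_all
  then show "q - inverse q \<noteq> 0" "q\<^sup>2 - inverse (q\<^sup>2) \<noteq> 0"
    using q_nonzero by (auto simp: field_simps power2_eq_square power4_eq_xxxx)
qed

lemma t_pair_adjacent:
  assumes "i < d"
  shows "t_pair q \<theta> i (Suc i) = a\<^sup>2 * (Q i * Q (Suc i))"
proof -
  have "t_pair q \<theta> i (Suc i) = 1 + ((\<theta> i - \<theta> (Suc i)) * (q * \<theta> i - inverse q * \<theta> (Suc i))) /
      ((q - inverse q) * (q\<^sup>2 - inverse (q\<^sup>2)))"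
    by (simp add: t_pair_def)
  also have "\<dots> = a\<^sup>2 * (Q i * Q (Suc i))"
    unfolding adjacent_difference_product[OF assms] using q_differences_nonzero by simp
  finally show ?thesis .
qed

lemma t_coeff_Suc: "i < d \<Longrightarrow> t_coeff q \<theta> (Suc i) = t_coeff q \<theta> i * (a\<^sup>2 * (Q i * Q (Suc i)))"
  by (simp add: t_coeff_def t_pair_adjacent mult.commute)

lemma t_coeff_nonzero: "i \<le> d \<Longrightarrow> t_coeff q \<theta> i \<noteq> 0"
proof (induction i)
  case 0
  then show ?case by (simp add: t_coeff_def)
next
  case (Suc i)
  then show ?case using Q_nonzero a_nonzero by (simp add: t_coeff_Suc)
qed

text \<open>
  As a polynomial in \<open>\<theta> i\<close> the quadratic has the roots \<open>a r y + a^-1 r^-1 y^-1\<close>, where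
  \<open>y = Q j\<close> and \<open>r\<close> is \<open>q^2\<close> or \<open>q^-2\<close>; these are the formal neighbours of
  \<open>\<theta> j\<close>. Each difference of \<open>\<theta> i\<close> and a root splits again into two factors. The
  first vanishes only for adjacent indices. If the second vanished, two eigenvalues would coincide,
  namely those at \<open>i\<close> and \<open>j\<close> with one index moved by one towards the other.
\<close>

lemma eigenvalue_quadratic_nonzero:
  assumes "i \<le> d" "j \<le> d" "i + 2 \<le> j \<or> j + 2 \<le> i"
  shows "(inverse q * \<theta> i - q * \<theta> j) * (q * \<theta> i - inverse q * \<theta> j) + (q\<^sup>2 - inverse (q\<^sup>2))\<^sup>2 \<noteq> 0"
proof -
  define p where "p = q\<^sup>2"
  define p' where "p' = inverse (q\<^sup>2)"
  define f where "f r r' = \<theta> i - (a * (r * Q j) + inverse a * (r' * inverse (Q j)))" for r r'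
  have one: "p * p' = 1" "a * inverse a = 1" "Q i * inverse (Q i) = 1" "Q j * inverse (Q j) = 1"
    "q * inverse q = 1"
    using q_nonzero a_nonzero Q_nonzero by (simp_all add: p_def p'_def)
  have factor: "f r r' = (Q i - r * Q j) * (a - inverse a * inverse (Q i) * r' * inverse (Q j))"
    if "r * r' = 1" for r r'
  proof -
    have identity: "b * x + b' * x' - (b * (r * y) + b' * (r' * y')) = (x - r * y) * (b - b' * x' * r' * y')"
      if "x * x' = 1" "y * y' = 1" "r * r' = 1" for b b' x x' y y' :: 'a
    proof -
      have "(x - r * y) * (b - b' * x' * r' * y') =
          b * x - b' * r' * y' * (x * x') - b * (r * y) + b' * x' * (y * y') * (r * r')"
        by (simp add: algebra_simps)
      then show ?thesis unfolding that by (simp add: algebra_simps)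
    qed
    show ?thesis
      unfolding f_def \<theta>_Q[OF assms(1)] by (rule identity[OF one(3,4) that])
  qed
  have neither: "f r r' \<noteq> 0" if r: "r * r' = 1" "r * Q j \<noteq> Q i" "a\<^sup>2 * (Q i * Q j) * r \<noteq> 1" for r r'
  proof
    assume "f r r' = 0"
    then have eq: "a = inverse a * inverse (Q i) * r' * inverse (Q j)"
      using factor[OF r(1)] r(2) by simp
    have "a * a * (Q i * Q j) * r = a * (inverse a * inverse (Q i) * r' * inverse (Q j)) * (Q i * Q j) * r"
      by (rule arg_cong[OF eq, of "\<lambda>t. a * t * (Q i * Q j) * r"])
    also have "\<dots> = (a * inverse a) * (Q i * inverse (Q i)) * (Q j * inverse (Q j)) * (r * r')"
      by (simp only: mult_ac)
    finally show False using r(3) unfolding one r(1) by (simp add: power2_eq_square)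
  qed
  have "p * Q j \<noteq> Q i" "p' * Q j \<noteq> Q i"
  proof -
    have up: "q\<^sup>2 * Q k \<noteq> Q l" if "l + 1 \<noteq> k" for k l
    proof -
      have "q\<^sup>2 * Q k = q powi (2 + (int d - 2 * int k))"
        unfolding Q_def by (subst power_int_add) (use q_nonzero in simp_all)
      moreover have "2 + (int d - 2 * int k) \<noteq> int d - 2 * int l" using that by linarith
      ultimately show ?thesis
        using power_int_inject_not_root[OF q_nonzero q_not_root] unfolding Q_def by metis
    qed
    show "p * Q j \<noteq> Q i" using up[of i j] assms(3) by (auto simp: p_def)
    have "q\<^sup>2 * Q i \<noteq> Q j" using up[of j i] assms(3) by auto
    then show "p' * Q j \<noteq> Q i" using q_nonzero by (auto simp: p'_def field_simps)
  qed
  moreover have "a\<^sup>2 * (Q i * Q j) * p \<noteq> 1 \<and> a\<^sup>2 * (Q i * Q j) * p' \<noteq> 1"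
  proof -
    have *: "a\<^sup>2 * (Q k * Q l) * p \<noteq> 1 \<and> a\<^sup>2 * (Q k * Q l) * p' \<noteq> 1" if kl: "k + 2 \<le> l" "l \<le> d" for k l
    proof
      obtain m where m: "l = Suc m" using kl by (cases l) auto
      have "Q m = p * Q l" using Q_Suc[of m] by (simp add: m p_def)
      then show "a\<^sup>2 * (Q k * Q l) * p \<noteq> 1"
        using Q_product[of k m] kl m by (simp add: mult_ac)
      have "p' * Q k = Q (Suc k)" using Q_Suc[of k] q_nonzero by (simp add: p'_def)
      then have "a\<^sup>2 * (p' * Q k * Q l) \<noteq> 1"
        using Q_product[of "Suc k" l] kl by simp
      then show "a\<^sup>2 * (Q k * Q l) * p' \<noteq> 1" by (simp only: mult_ac not_False_eq_True)
    qed
    show ?thesis using *[of i j] *[of j i] assms by (metis mult.commute)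
  qed
  ultimately have "f p p' * f p' p \<noteq> 0"
    using neither[of p p'] neither[of p' p] one(1) by (simp add: mult.commute)
  moreover have "(inverse q * \<theta> i - q * \<theta> j) * (q * \<theta> i - inverse q * \<theta> j) + (q\<^sup>2 - inverse (q\<^sup>2))\<^sup>2
      = f p p' * f p' p"
  proof -
    have identity: "(s' * t - s * (b * y + b' * y')) * (s * t - s' * (b * y + b' * y')) + (s\<^sup>2 - s'\<^sup>2)\<^sup>2 =
        (t - (b * (s\<^sup>2 * y) + b' * (s'\<^sup>2 * y'))) * (t - (b * (s'\<^sup>2 * y) + b' * (s\<^sup>2 * y')))"
      if "b * b' = 1" "y * y' = 1" "s * s' = 1" for b b' y y' s s' t :: 'a
    proof -
      let ?u = "b * y + b' * y'"
      have "(s' * t - s * ?u) * (s * t - s' * ?u) + (s\<^sup>2 - s'\<^sup>2)\<^sup>2 =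
          (s * s') * (t\<^sup>2 + ?u\<^sup>2) - (s\<^sup>2 + s'\<^sup>2) * t * ?u + s^4 + s'^4 - 2 * (s * s')\<^sup>2"
        by (simp add: algebra_simps power2_eq_square power4_eq_xxxx)
      also have "\<dots> = t\<^sup>2 + (b * y)\<^sup>2 + (b' * y')\<^sup>2 + 2 * ((b * b') * (y * y'))
          - (s\<^sup>2 + s'\<^sup>2) * t * ?u + s^4 + s'^4 - 2"
        unfolding that(3) by (simp add: algebra_simps power2_eq_square)
      also have "\<dots> = t\<^sup>2 + (b * y)\<^sup>2 + (b' * y')\<^sup>2 - (s\<^sup>2 + s'\<^sup>2) * t * ?u + s^4 + s'^4"
        unfolding that(1,2) by simp
      finally have left: "(s' * t - s * ?u) * (s * t - s' * ?u) + (s\<^sup>2 - s'\<^sup>2)\<^sup>2 = \<dots>" .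
      have "(t - (b * (s\<^sup>2 * y) + b' * (s'\<^sup>2 * y'))) * (t - (b * (s'\<^sup>2 * y) + b' * (s\<^sup>2 * y'))) =
          t\<^sup>2 - (s\<^sup>2 + s'\<^sup>2) * t * ?u + (s * s')\<^sup>2 * ((b * y)\<^sup>2 + (b' * y')\<^sup>2)
          + (b * b') * (y * y') * (s^4 + s'^4)"
        by (simp add: algebra_simps power2_eq_square power4_eq_xxxx)
      then show ?thesis unfolding left that by simp
    qed
    show ?thesis
      unfolding f_def p_def p'_def \<theta>_Q[OF assms(2)] power_inverse[symmetric]
      by (rule identity[OF one(2,4,5)])
  qed
  ultimately show ?thesis by simp
qed

end

section \<open>Relations of A with B and with a A - a^2 B^-1\<close>

locale q_tridiagonal_system = tridiagonal_system scale A Astar d \<theta> \<theta>star + q_racah_sequence q a d \<theta>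
  for scale :: "'a::field \<Rightarrow> 'b::ab_group_add \<Rightarrow> 'b" (infixr \<open>*s\<close> 75)
    and A Astar d \<theta> \<theta>star q a
begin

definition B :: "'b \<Rightarrow> 'b" where
  "B = decomp_map scale q d W"

definition Binv :: "'b \<Rightarrow> 'b" where
  "Binv = inv_into UNIV B"

definition Bplus :: "'b \<Rightarrow> 'b" where
  "Bplus v = a *s A v - a\<^sup>2 *s Binv v"

lemma endo_B: "endo B" and B_W: "i \<le> d \<Longrightarrow> w \<in> W i \<Longrightarrow> B w = Q i *s w"
  using decomp_map[OF decomposition_W] by (simp_all add: B_def Q_def)

lemma triangular_B_Ustar: "triangular d Ustar B Q"
  using split_map_triangular(1)[where c = Q, OF endo_B B_W] .

lemma triangular_B_U: "triangular d U B (\<lambda>i. inverse (Q i))"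
  using split_map_triangular(2)[where c = Q, OF endo_B B_W] by (rule triangular_cong) (simp_all add: Q_reverse)

lemma bij_B: "bij B"
  by (rule triangular_bij[OF endo_B flag_Ustar triangular_B_Ustar]) (rule Q_nonzero)

lemma Binv_B: "Binv (B v) = v"
  by (simp add: Binv_def inv_f_f[OF bij_is_inj[OF bij_B]])

lemma endo_Binv: "endo Binv"
  unfolding Binv_def by (rule endo_inv[OF endo_B bij_B])

lemma triangular_Binv_Ustar: "triangular d Ustar Binv (\<lambda>i. inverse (Q i))"
  unfolding Binv_def by (rule triangular_inv[OF endo_B flag_Ustar triangular_B_Ustar]) (rule Q_nonzero)

lemma triangular_Binv_U: "triangular d U Binv Q"
  using triangular_inv[OF endo_B flag_U triangular_B_U] Q_nonzero by (simp add: Binv_def)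

lemma endo_Bplus: "endo Bplus"
  unfolding Bplus_def[abs_def] by (rule endo_scaled_diff[OF endo_A endo_Binv])

text \<open>
  The summand \<open>a^2 Q i\<close> of \<open>a \<theta> i\<close> cancels, so \<open>Bplus\<close> has the same diagonal as \<open>B\<close>.
\<close>

lemma triangular_Bplus_U: "triangular d U Bplus (\<lambda>i. inverse (Q i))"
  unfolding Bplus_def[abs_def]
  using triangular_scaled_diff[OF flag_U triangular_A triangular_Binv_U]
proof (rule triangular_cong)
  fix i assume "i \<le> d"
  then show "a * \<theta> i - a\<^sup>2 * Q i = inverse (Q i)"
    using a_nonzero by (simp add: \<theta>_Q field_simps power2_eq_square)
qed

lemma Binv_W: "i \<le> d \<Longrightarrow> w \<in> W i \<Longrightarrow> Binv w = inverse (Q i) *s w"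
proof -
  assume w: "i \<le> d" "w \<in> W i"
  have "Binv w = Binv (B (inverse (Q i) *s w))"
    using w Q_nonzero[of i] by (simp add: endo_scale[OF endo_B] B_W)
  then show ?thesis by (simp only: Binv_B)
qed

text \<open>
  At the last index the remainder \<open>r\<close> is zero, so that the two equations for it hold there too.
\<close>

lemma A_W_split:
  assumes "i \<le> d" "w \<in> W i"
  obtains r where "A w = (a * inverse (Q i) + inverse a * Q i) *s w + r"
    "B r = (Q i / q\<^sup>2) *s r" "Binv r = (q\<^sup>2 / Q i) *s r"
proof
  define r where "r = A w - \<theta> (d - i) *s w"
  show "A w = (a * inverse (Q i) + inverse a * Q i) *s w + (A w - \<theta> (d - i) *s w)"
    using assms \<theta>_Q[of "d - i"] by (simp add: Q_reverse)
  have "B r = (Q i / q\<^sup>2) *s r \<and> Binv r = (q\<^sup>2 / Q i) *s r"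
  proof (cases "i < d")
    case True
    then have "r \<in> W (Suc i)" using A_W(1)[OF assms] by (simp add: r_def)
    moreover have "Q (Suc i) = Q i / q\<^sup>2" using Q_Suc[of i] q_nonzero by simp
    moreover from this have "inverse (Q (Suc i)) = q\<^sup>2 / Q i" by simp
    ultimately show ?thesis using True B_W[of "Suc i" r] Binv_W[of "Suc i" r] by simp
  next
    case False
    then have "r = 0" using A_W(2)[OF assms] assms(1) by (simp add: r_def)
    then show ?thesis by (simp add: endo_zero endo_B endo_Binv)
  qed
  then show "B (A w - \<theta> (d - i) *s w) = (Q i / q\<^sup>2) *s (A w - \<theta> (d - i) *s w)"
    "Binv (A w - \<theta> (d - i) *s w) = (q\<^sup>2 / Q i) *s (A w - \<theta> (d - i) *s w)"
    by (simp_all only: r_def)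
qed

lemma endo_eq_on_W:
  assumes "endo f" "endo g" "\<And>i w. i \<le> d \<Longrightarrow> w \<in> W i \<Longrightarrow> f w = g w"
  shows "f v = g v"
proof -
  obtain s where s: "\<forall>i\<le>d. s i \<in> W i" "v = (\<Sum>i\<le>d. s i)"
    using decomposition_W unfolding decomposition_def by blast
  have "(\<Sum>i\<le>d. f (s i)) = (\<Sum>i\<le>d. g (s i))"
    by (rule sum.cong) (use s(1) assms(3) in auto)
  then show ?thesis unfolding s(2) by (simp only: endo_sum[OF assms(1)] endo_sum[OF assms(2)])
qed

text \<open>
  Write \<open>A = a B^-1 + a^-1 B + R\<close> with \<open>R\<close> raising the index of \<open>W\<close>. Then
  \<open>B R = q^-2 R B\<close>, so \<open>R\<close> drops out of the \<open>q\<close>-commutator of \<open>B\<close> and \<open>A\<close>.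
\<close>

lemma B_A_relation:
  "q *s B (A v) - inverse q *s A (B v) = (q - inverse q) *s (a *s v + inverse a *s B (B v))"
proof (rule endo_eq_on_W[where f = "\<lambda>v. q *s B (A v) - inverse q *s A (B v)"
      and g = "\<lambda>v. (q - inverse q) *s (a *s v + inverse a *s B (B v))"])
  show "endo (\<lambda>v. q *s B (A v) - inverse q *s A (B v))"
    "endo (\<lambda>v. (q - inverse q) *s (a *s v + inverse a *s B (B v)))"
    by (rule endoI; simp add: endo_simps endo_A endo_B algebra_simps)+
  fix i w assume w: "i \<le> d" "w \<in> W i"
  obtain r where r: "A w = (a * inverse (Q i) + inverse a * Q i) *s w + r"
    "B r = (Q i / q\<^sup>2) *s r"
    using A_W_split[OF w] by blast
  note Bw = B_W[OF w]
  have "q *s B (A w) - inverse q *s A (B w) =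
      ((q - inverse q) * (a * inverse (Q i) + inverse a * Q i) * Q i) *s w +
      (q * (Q i / q\<^sup>2) - inverse q * Q i) *s r"
    by (simp add: r Bw endo_simps endo_A endo_B algebra_simps)
  also have "q * (Q i / q\<^sup>2) - inverse q * Q i = 0"
    using q_nonzero by (simp add: field_simps power2_eq_square)
  also have "(q - inverse q) * (a * inverse (Q i) + inverse a * Q i) * Q i =
      (q - inverse q) * (a + inverse a * (Q i * Q i))"
    using Q_nonzero[of i] by (simp add: algebra_simps)
  finally show "q *s B (A w) - inverse q *s A (B w) =
      (q - inverse q) *s (a *s w + inverse a *s B (B w))"
    by (simp add: Bw endo_simps endo_B algebra_simps)
qed

text \<open>
  Here \<open>Bplus = B + a R\<close> with the raising map \<open>R\<close> of the previous relation, which drops out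
  again.
\<close>

lemma Bplus_Binv_relation: "q *s Bplus (Binv v) - inverse q *s Binv (Bplus v) = (q - inverse q) *s v"
proof (rule endo_eq_on_W[where f = "\<lambda>v. q *s Bplus (Binv v) - inverse q *s Binv (Bplus v)"
      and g = "\<lambda>v. (q - inverse q) *s v"])
  show "endo (\<lambda>v. q *s Bplus (Binv v) - inverse q *s Binv (Bplus v))" "endo (\<lambda>v. (q - inverse q) *s v)"
    by (rule endoI; simp add: endo_simps endo_Bplus endo_Binv algebra_simps)+
  fix i w assume w: "i \<le> d" "w \<in> W i"
  obtain r where r: "A w = (a * inverse (Q i) + inverse a * Q i) *s w + r"
    "Binv r = (q\<^sup>2 / Q i) *s r"
    using A_W_split[OF w] by blast
  have Xw: "Bplus w = Q i *s w + a *s r"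
  proof -
    have "Bplus w = (a * (a * inverse (Q i) + inverse a * Q i) - a\<^sup>2 * inverse (Q i)) *s w + a *s r"
      by (simp add: Bplus_def r Binv_W[OF w] algebra_simps)
    also have "a * (a * inverse (Q i) + inverse a * Q i) - a\<^sup>2 * inverse (Q i) = Q i"
      using a_nonzero by (simp add: algebra_simps power2_eq_square)
    finally show ?thesis .
  qed
  have "q *s Bplus (Binv w) - inverse q *s Binv (Bplus w) =
      (q * inverse (Q i) * Q i - inverse q * Q i * inverse (Q i)) *s w +
      (q * inverse (Q i) * a - inverse q * a * (q\<^sup>2 / Q i)) *s r"
    by (simp add: Xw Binv_W[OF w] r endo_simps endo_Bplus endo_Binv algebra_simps)
  also have "q * inverse (Q i) * a - inverse q * a * (q\<^sup>2 / Q i) = 0"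
    using q_nonzero Q_nonzero[of i] by (simp add: field_simps power2_eq_square)
  also have "q * inverse (Q i) * Q i - inverse q * Q i * inverse (Q i) = q - inverse q"
    using Q_nonzero[of i] by (simp add: mult.assoc)
  finally show "q *s Bplus (Binv w) - inverse q *s Binv (Bplus w) = (q - inverse q) *s w" by simp
qed

lemma A_Bplus: "A v = a *s Binv v + inverse a *s Bplus v"
proof -
  have "inverse a *s Bplus v = (inverse a * a) *s A v - (inverse a * a\<^sup>2) *s Binv v"
    by (simp only: Bplus_def scale_right_diff_distrib scale_scale)
  also have "\<dots> = A v - a *s Binv v"
    using a_nonzero by (simp add: power2_eq_square)
  finally show ?thesis by simp
qed

text \<open>
  The same relation as for \<open>B\<close>. Together with its diagonal and its first superdiagonal it
  determines a triangular map, which is why \<open>B\<close> and \<open>Bplus\<close> turn out to be conjugate by a function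
  of \<open>A\<close>.
\<close>

lemma Bplus_A_relation:
  "q *s Bplus (A v) - inverse q *s A (Bplus v) = (q - inverse q) *s (a *s v + inverse a *s Bplus (Bplus v))"
proof -
  have "q *s Bplus (A v) - inverse q *s A (Bplus v) =
      a *s (q *s Bplus (Binv v) - inverse q *s Binv (Bplus v)) + inverse a *s (q - inverse q) *s Bplus (Bplus v)"
    unfolding A_Bplus[of v] A_Bplus[of "Bplus v"] endo_add[OF endo_Bplus] endo_scale[OF endo_Bplus]
    by (simp add: algebra_simps)
  then show ?thesis unfolding Bplus_Binv_relation by (simp add: algebra_simps)
qed

text \<open>
  The coefficient factors as \<open>(q Q j - q^-1 Q i) (a - a^-1 / (Q i * Q j))\<close>. Its first factor
  vanishes for \<open>j = i + 1\<close>, whence the gap of two.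
\<close>

lemma relation_coefficient_nonzero:
  assumes "i + 2 \<le> j" "j \<le> d"
  shows "q * \<theta> j - inverse q * \<theta> i
    - (q - inverse q) * inverse a * (inverse (Q j) + inverse (Q i)) \<noteq> 0"
proof -
  obtain k where k: "j = Suc k" using assms by (cases j) auto
  have "q * Q j - inverse q * Q i \<noteq> 0"
  proof
    assume "q * Q j - inverse q * Q i = 0"
    then have "Q i = q\<^sup>2 * Q j" using q_nonzero by (simp add: field_simps power2_eq_square)
    then have "Q i = Q k" unfolding k by (simp only: Q_Suc[of k])
    then show False using assms k by (simp add: Q_inject)
  qed
  moreover have "a - inverse a * inverse (Q i) * inverse (Q j) \<noteq> 0"
  proof
    assume "a - inverse a * inverse (Q i) * inverse (Q j) = 0"
    then have "a\<^sup>2 * (Q i * Q j) = 1"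
      using a_nonzero Q_nonzero[of i] Q_nonzero[of j] by (simp add: field_simps power2_eq_square)
    then show False using Q_product[of i j] assms by simp
  qed
  moreover have "q * \<theta> j - inverse q * \<theta> i
      - (q - inverse q) * inverse a * (inverse (Q j) + inverse (Q i))
    = (q * Q j - inverse q * Q i) * (a - inverse a * inverse (Q i) * inverse (Q j))"
  proof -
    have "p * (b * y + b' * y') - p' * (b * x + b' * x') - (p - p') * b' * (y' + x')
        = (p * y - p' * x) * (b - b' * x' * y')"
      if "x * x' = 1" "y * y' = 1" for p p' b b' x x' y y' :: 'a
    proof -
      have "(p * y - p' * x) * (b - b' * x' * y')
          = p * b * y - p' * b * x - p * b' * x' * (y * y') + p' * b' * y' * (x * x')"
        by (simp add: algebra_simps)
      then show ?thesis unfolding that by (simp add: algebra_simps)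
    qed
    from this[OF right_inverse[OF Q_nonzero] right_inverse[OF Q_nonzero]]
    show ?thesis using assms by (simp only: \<theta>_Q)
  qed
  ultimately show ?thesis by simp
qed

end

section \<open>Conjugation by H\<close>

text \<open>
  Only the ratios of consecutive eigenvalues of \<open>H\<close> are prescribed. Reversing the order of the
  eigenspaces of \<open>A\<close> changes the numbers \<open>t_i\<close> by a common factor, so the assumptions on a fixed
  \<open>H\<close> survive the reversal.
\<close>

locale q_conjugating_system = q_tridiagonal_system scale A Astar d \<theta> \<theta>star q a
  for scale :: "'a::field \<Rightarrow> 'b::ab_group_add \<Rightarrow> 'b" (infixr \<open>*s\<close> 75)
    and A Astar d \<theta> \<theta>star q a +
  fixes H :: "'b \<Rightarrow> 'b" and h :: "nat \<Rightarrow> 'a"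
  assumes endo_H: "endo H"
    and H_eigen: "i \<le> d \<Longrightarrow> v \<in> eigenspace scale A (\<theta> i) \<Longrightarrow> H v = h i *s v"
    and h_nonzero: "i \<le> d \<Longrightarrow> h i \<noteq> 0"
    and h_Suc: "i < d \<Longrightarrow> h (Suc i) = h i * (a\<^sup>2 * (Q i * Q (Suc i)))"
begin

lemma triangular_H: "triangular d U H h"
  unfolding triangular_def
proof (intro allI impI ballI)
  fix i v assume i: "i \<le> d" "v \<in> U (Suc i)"
  then obtain s where s: "\<forall>j<Suc i. s j \<in> eigenspace scale A (\<theta> j)" "v = (\<Sum>j<Suc i. s j)"
    by (auto simp: U_def set_sum_alt simp del: sum.lessThan_Suc)
  have "H v - h i *s v = (\<Sum>j<Suc i. (h j - h i) *s s j)"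
    unfolding s(2) endo_sum[OF endo_H] scale_sum_right sum_subtractf[symmetric]
    by (rule sum.cong) (use s(1) i H_eigen in \<open>simp_all add: scale_left_diff_distrib\<close>)
  also have "\<dots> = (\<Sum>j<i. (h j - h i) *s s j)" by simp
  also have "\<dots> \<in> U i"
  proof (rule subspace_sum[OF subspace_U])
    fix j assume j: "j \<in> {..<i}"
    then have "s j \<in> span (\<Union>j<i. eigenspace scale A (\<theta> j))"
      using s(1) by (intro span_base UN_I[of j]) auto
    then show "(h j - h i) *s s j \<in> U i"
      unfolding U_def eigenspace_sum_eq_span[OF endo_A] by (rule span_scale)
  qed (use i in simp)
  finally show "H v - h i *s v \<in> U i" .
qed

lemma bij_H: "bij H"
  by (rule triangular_bij[OF endo_H flag_U triangular_H]) (rule h_nonzero)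

lemma H_A: "H (A v) = A (H v)"
proof -
  have "v \<in> (\<Sum>j\<le>d. eigenspace scale A (\<theta> j))" using V_sum by simp
  then obtain s where s: "\<forall>j\<le>d. s j \<in> eigenspace scale A (\<theta> j)" "v = (\<Sum>j\<le>d. s j)"
    by (auto simp: set_sum_alt)
  have "(\<Sum>j\<le>d. H (A (s j))) = (\<Sum>j\<le>d. A (H (s j)))"
  proof (rule sum.cong)
    fix j assume j: "j \<in> {..d}"
    then have "A (s j) = \<theta> j *s s j" using s(1) by (simp add: eigenspace_def)
    moreover have "H (s j) = h j *s s j" using s(1) j H_eigen by simp
    ultimately show "H (A (s j)) = A (H (s j))"
      by (simp add: endo_scale[OF endo_A] endo_scale[OF endo_H] mult.commute)
  qed simp
  then show ?thesis unfolding s(2) by (simp only: endo_sum[OF endo_A] endo_sum[OF endo_H])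
qed

definition D :: "'b \<Rightarrow> 'b" where
  "D v = H (Bplus v) - B (H v)"

lemma endo_D: "endo D"
  by (rule endoI) (simp_all add: D_def endo_simps endo_H endo_Bplus endo_B algebra_simps)

text \<open>
  As \<open>H\<close> commutes with \<open>A\<close>, the relations for \<open>Bplus\<close> and \<open>B\<close> can be subtracted; the
  quadratic terms combine by \<open>H P^2 - B^2 H = D P + B D\<close>, where \<open>P = Bplus\<close>.
\<close>

lemma D_A_relation:
  "q *s D (A v) - inverse q *s A (D v) = ((q - inverse q) * inverse a) *s (D (Bplus v) + B (D v))"
proof -
  have "q *s D (A v) - inverse q *s A (D v) =
      H (q *s Bplus (A v) - inverse q *s A (Bplus v)) - (q *s B (A (H v)) - inverse q *s A (B (H v)))"
    by (simp add: D_def H_A endo_simps endo_A endo_H algebra_simps)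
  also have "\<dots> = ((q - inverse q) * inverse a) *s (H (Bplus (Bplus v)) - B (B (H v)))"
    unfolding Bplus_A_relation B_A_relation by (simp add: endo_simps endo_H algebra_simps)
  also have "H (Bplus (Bplus v)) - B (B (H v)) = D (Bplus v) + B (D v)"
    by (simp add: D_def endo_simps endo_B)
  finally show ?thesis .
qed

text \<open>
  Let \<open>B z = z / Q j + w\<close>. Up to lower terms the component \<open>w\<close> of \<open>B z\<close> becomes
  \<open>a^2 Q j Q (j - 1) w\<close> in \<open>Bplus z\<close>, because \<open>B^-1\<close> contributes the inverse diagonal entries
  of the two steps involved. This is the ratio of the eigenvalues of \<open>H\<close> on these steps, so the two
  contributions to \<open>D z\<close> cancel.
\<close>

lemma D_eigen:
  assumes j: "j \<le> d" and z: "z \<in> eigenspace scale A (\<theta> j)"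
  shows "D z \<in> U (j - 1)"
proof -
  have zU: "z \<in> U (Suc j)"
  proof -
    have "z \<in> span (\<Union>i<Suc j. eigenspace scale A (\<theta> i))" using z by (intro span_base) auto
    then show ?thesis unfolding U_def eigenspace_sum_eq_span[OF endo_A] .
  qed
  define w where "w = B z - inverse (Q j) *s z"
  have w: "w \<in> U j" unfolding w_def by (rule triangularD[OF triangular_B_U j zU])
  have Bz: "B z = inverse (Q j) *s z + w" by (simp add: w_def)
  have "z = inverse (Q j) *s Binv z + Binv w"
    using Binv_B[of z] unfolding Bz by (simp add: endo_simps[OF endo_Binv])
  then have "Q j *s (z - Binv w) = Q j *s inverse (Q j) *s Binv z"
    by (metis add_diff_cancel_right')
  then have Binv_z: "Binv z = Q j *s (z - Binv w)" using Q_nonzero[of j] by simp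
  have Hz: "H z = h j *s z" by (rule H_eigen[OF j z])
  have Az: "A z = \<theta> j *s z" using z by (simp add: eigenspace_def)
  have "Bplus z = (a * \<theta> j - a\<^sup>2 * Q j) *s z + (a\<^sup>2 * Q j) *s Binv w"
    by (simp add: Bplus_def Az Binv_z algebra_simps)
  also have "a * \<theta> j - a\<^sup>2 * Q j = inverse (Q j)"
    using a_nonzero by (simp add: \<theta>_Q[OF j] algebra_simps power2_eq_square)
  finally have Dz: "D z = (a\<^sup>2 * Q j) *s H (Binv w) - h j *s w"
    by (simp add: D_def Hz Bz endo_simps endo_H endo_B algebra_simps)
  show ?thesis
  proof (cases j)
    case 0
    then have "w = 0" using w flag_0[OF flag_U] by simp
    then show ?thesis using 0 by (simp add: Dz endo_zero endo_H endo_Binv subspace_0 subspace_U)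
  next
    case (Suc i)
    then have i: "i \<le> d" "i < d" and wi: "w \<in> U (Suc i)" using j w by auto
    define u1 where "u1 = Binv w - Q i *s w"
    define u2 where "u2 = H w - h i *s w"
    have u1: "u1 \<in> U i" unfolding u1_def by (rule triangularD[OF triangular_Binv_U i(1) wi])
    have u2: "u2 \<in> U i" unfolding u2_def by (rule triangularD[OF triangular_H i(1) wi])
    have Hu1: "H u1 \<in> U i" using triangular_invariant[OF flag_U triangular_H _ u1] i by simp
    have "H (Binv w) = H u1 + Q i *s (u2 + h i *s w)"
      by (simp add: u1_def u2_def endo_simps endo_H)
    then have "D z = (a\<^sup>2 * Q j) *s (H u1 + Q i *s u2) + (a\<^sup>2 * Q j * Q i * h i - h j) *s w"
      by (simp add: Dz algebra_simps)
    also have "a\<^sup>2 * Q j * Q i * h i - h j = 0"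
      using h_Suc[OF i(2)] Suc by (simp add: algebra_simps)
    finally have "D z = (a\<^sup>2 * Q j) *s (H u1 + Q i *s u2)" by simp
    moreover have "subspace (U i)" using i by (simp add: subspace_U)
    ultimately show ?thesis
      using Suc Hu1 u2 by (simp add: subspace_add subspace_scale)
  qed
qed

lemma D_lowers_by_two:
  assumes "n \<le> Suc d" "v \<in> U n"
  shows "D v \<in> U (n - 2)"
  using assms
proof (induction n arbitrary: v)
  case 0
  then show ?case by (simp add: flag_0[OF flag_U] endo_zero[OF endo_D])
next
  case (Suc j)
  then obtain y z where v: "v = y + z" "y \<in> U j" "z \<in> eigenspace scale A (\<theta> j)"
    by (auto simp: U_def elim!: set_plus_elim)
  have sub: "subspace (U (j - 1))" using Suc.prems by (simp add: subspace_U)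
  have "D y \<in> U (j - 2)" using Suc.IH[OF _ v(2)] Suc.prems by simp
  moreover have "U (j - 2) \<subseteq> U (j - 1)" by (rule flag_mono[OF flag_U]) (use Suc.prems in auto)
  moreover have "D z \<in> U (j - 1)" using D_eigen[OF _ v(3)] Suc.prems by simp
  ultimately have "D y + D z \<in> U (j - 1)" by (intro subspace_add[OF sub]) auto
  then show ?case by (simp add: v(1) endo_add[OF endo_D] numeral_2_eq_2)
qed

text \<open>
  For \<open>v\<close> of index \<open>j\<close> and \<open>u = D v\<close> of index \<open>i = j - k\<close>, every map in the relation for
  \<open>D\<close> may be replaced by its diagonal entry modulo \<open>U i\<close>. What remains is a nonzero multiple
  of \<open>u\<close>.
\<close>

lemma D_lowers_step:
  assumes k: "k \<ge> 2" and IH: "\<And>n v. n \<le> Suc d \<Longrightarrow> v \<in> U n \<Longrightarrow> D v \<in> U (n - k)"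
    and n: "n \<le> Suc d" and v: "v \<in> U n"
  shows "D v \<in> U (n - Suc k)"
proof (cases "n - k")
  case 0
  then show ?thesis using IH[OF n v] by (metis diff_Suc pred_def nat.case(1) old.nat.simps(4))
next
  case (Suc i)
  define j where "j = n - 1"
  have j: "n = Suc j" "j - k = i" "n - Suc k = i" "i + 2 \<le> j" "j \<le> d" "i \<le> d"
    using Suc k n unfolding j_def by linarith+
  have sub: "subspace (U i)" using j by (simp add: subspace_U)
  define \<kappa> where "\<kappa> = (q - inverse q) * inverse a"
  define c where "c = q * \<theta> j - inverse q * \<theta> i - \<kappa> * (inverse (Q j) + inverse (Q i))"
  define u where "u = D v"
  have u: "u \<in> U (Suc i)" using IH[OF n v] Suc by (simp add: u_def)
  have vj: "v \<in> U (Suc j)" using v j by simp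
  define v1 where "v1 = A v - \<theta> j *s v"
  define v2 where "v2 = Bplus v - inverse (Q j) *s v"
  define u1 where "u1 = A u - \<theta> i *s u"
  define u2 where "u2 = B u - inverse (Q i) *s u"
  have "v1 \<in> U j" unfolding v1_def by (rule triangularD[OF triangular_A j(5) vj])
  then have v1: "D v1 \<in> U i" using IH[of j v1] j by simp
  have "v2 \<in> U j" unfolding v2_def by (rule triangularD[OF triangular_Bplus_U j(5) vj])
  then have v2: "D v2 \<in> U i" using IH[of j v2] j by simp
  have u1: "u1 \<in> U i" unfolding u1_def by (rule triangularD[OF triangular_A j(6) u])
  have u2: "u2 \<in> U i" unfolding u2_def by (rule triangularD[OF triangular_B_U j(6) u])
  have "q *s D (\<theta> j *s v + v1) - inverse q *s (\<theta> i *s u + u1) =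
      \<kappa> *s (D (inverse (Q j) *s v + v2) + (inverse (Q i) *s u + u2))"
    using D_A_relation[of v] by (simp add: v1_def v2_def u1_def u2_def \<kappa>_def u_def)
  then have "q *s D (\<theta> j *s v + v1) - inverse q *s (\<theta> i *s u + u1)
      - \<kappa> *s (D (inverse (Q j) *s v + v2) + (inverse (Q i) *s u + u2)) = 0" by simp
  then have "c *s u = \<kappa> *s (D v2 + u2) + inverse q *s u1 - q *s D v1"
    by (simp add: endo_simps[OF endo_D] u_def[symmetric] c_def algebra_simps)
  also have "\<dots> \<in> U i"
    using v1 v2 u1 u2 by (intro subspace_add[OF sub] subspace_diff[OF sub] subspace_scale[OF sub])
  finally have "inverse c *s c *s u \<in> U i" by (rule subspace_scale[OF sub])
  moreover have "c \<noteq> 0"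
    using relation_coefficient_nonzero[OF j(4,5)] by (simp add: c_def \<kappa>_def)
  ultimately show ?thesis using j by (simp add: u_def)
qed

text \<open>
  The flag has \<open>d + 1\<close> steps, so a map that lowers the index by \<open>d + 2\<close> vanishes.
\<close>

lemma D_eq_0: "D v = 0"
proof -
  have "n \<le> Suc d \<Longrightarrow> v \<in> U n \<Longrightarrow> D v \<in> U (n - (k + 2))" for k n v
  proof (induction k arbitrary: n v)
    case 0
    then show ?case unfolding add_0 by (rule D_lowers_by_two)
  next
    case (Suc k)
    have "D v \<in> U (n - Suc (k + 2))"
      using D_lowers_step[of "k + 2" n v] Suc by simp
    then show ?case by simp
  qed
  from this[of "Suc d" v d] have "D v \<in> U 0" by (simp add: flag_UNIV[OF flag_U])
  then show ?thesis by (simp add: flag_0[OF flag_U])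
qed

lemma H_Bplus: "H (Bplus v) = B (H v)"
  using D_eq_0[of v] by (simp add: D_def)

definition Uplus :: "nat \<Rightarrow> 'b set" where
  "Uplus n = {v. H v \<in> Ustar n}"

lemma flag_Uplus: "flag d Uplus"
  unfolding Uplus_def[abs_def] by (rule flag_vimage[OF endo_H bij_H flag_Ustar])

lemma triangular_Bplus_Uplus: "triangular d Uplus Bplus Q"
  unfolding Uplus_def[abs_def]
  by (rule triangular_conjugate[where g = Bplus, OF endo_H triangular_B_Ustar]) (rule H_Bplus)

lemma inj_Q: "inj_on (\<lambda>i. q powi (int d - 2 * int i)) {..d}"
  by (rule inj_onI) (rule iffD1[OF Q_inject[unfolded Q_def]])

lemma B_goes_from_to: "goes_from_to scale q d B (\<lambda>i. Ustar (Suc i)) (\<lambda>i. U (Suc i))"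
  by (rule goes_from_toI[OF endo_B flag_Ustar flag_U triangular_B_Ustar[unfolded Q_def[abs_def]]
        triangular_B_U[unfolded inverse_Q] inj_Q]) (rule refl)+

lemma Bplus_goes_from_to: "goes_from_to scale q d Bplus (\<lambda>i. Uplus (Suc i)) (\<lambda>i. U (Suc i))"
  by (rule goes_from_toI[OF endo_Bplus flag_Uplus flag_U triangular_Bplus_Uplus[unfolded Q_def[abs_def]]
        triangular_Bplus_U[unfolded inverse_Q] inj_Q]) (rule refl)+

end

section \<open>Representations of the q-Onsager algebra\<close>

lemma ring_ring_of_type_algebra: "ring (ring_of_type_algebra :: 'a::ring_1 ring)"
proof -
  have "\<exists>y. x + y = 0" for x :: 'a
    using add.right_inverse by blast
  then show ?thesis
    unfolding ring_of_type_algebra_def using add.right_inverse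
    by unfold_locales (auto simp: algebra_simps Units_def)
qed

lemma carrier_ring_of_type_algebra: "carrier ring_of_type_algebra = UNIV"
  by (simp add: ring_of_type_algebra_def)

lemma ideal_onsager_ideal: "ideal (onsager_ideal q) ring_of_type_algebra"
  unfolding onsager_ideal_def
  by (rule ring.genideal_ideal[OF ring_ring_of_type_algebra])
    (simp add: carrier_ring_of_type_algebra)

lemma onsager_class_hom:
  "onsager_class q \<in> ring_hom ring_of_type_algebra (onsager_algebra q)"
  using ideal.rcos_ring_hom[OF ideal_onsager_ideal]
  by (simp add: onsager_class_def[abs_def] onsager_algebra_def)

lemma onsager_class_cases:
  assumes "x \<in> carrier (onsager_algebra q)"
  obtains y where "x = onsager_class q y"
  using assms
  by (auto simp: onsager_algebra_def onsager_class_def FactRing_def A_RCOSETS_def')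

lemma onsager_class_relator:
  assumes "r \<in> {onsager_relator q (free_gen Gen_A) (free_gen Gen_Astar),
        onsager_relator q (free_gen Gen_Astar) (free_gen Gen_A)}"
  shows "onsager_class q r = onsager_class q 0"
proof -
  have "r \<in> onsager_ideal q"
    unfolding onsager_ideal_def
    by (rule subsetD[OF ring.genideal_self[OF ring_ring_of_type_algebra] assms])
      (simp add: carrier_ring_of_type_algebra)
  moreover have "0 \<in> onsager_ideal q"
    using additive_subgroup.zero_closed[OF ideal.axioms(1)[OF ideal_onsager_ideal]]
    by (simp add: ring_of_type_algebra_def)
  moreover have "onsager_ideal q +>\<^bsub>ring_of_type_algebra\<^esub> h = onsager_ideal q"
    if "h \<in> onsager_ideal q" for h
    using abelian_subgroup.a_rcos_const[OF abelian_subgroupI3[OF ideal.axioms(1)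
          [OF ideal_onsager_ideal] ring.is_abelian_group[OF ring_ring_of_type_algebra]] that] .
  ultimately show ?thesis
    unfolding onsager_class_def by metis
qed

text \<open>
  Words are products of generators and every element is a finite sum of scalar multiples of words.
\<close>

lemma free_algebra_induct:
  fixes x :: "('f::field) onsager_free"
  assumes scal: "\<And>c. P (free_scal c)" and gen: "\<And>g. P (free_gen g)"
    and add: "\<And>x y. P x \<Longrightarrow> P y \<Longrightarrow> P (x + y)" and mult: "\<And>x y. P x \<Longrightarrow> P y \<Longrightarrow> P (x * y)"
  shows "P x"
proof -
  have word: "P (Poly_Mapping.single (Word gs) 1)" for gs
  proof (induction gs)
    case Nil
    then show ?case using scal[of 1] by (simp add: free_scal_def zero_word_def)
  next
    case (Cons g gs)
    have "free_gen g * Poly_Mapping.single (Word gs) 1 = Poly_Mapping.single (Word (g # gs)) (1 :: 'f)"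
      by (simp add: free_gen_def mult_single plus_word_def)
    then show ?case using mult[OF gen Cons, of g] by simp
  qed
  have single: "P (Poly_Mapping.single w c)" for w c
  proof (cases w)
    case (Word gs)
    have "free_scal c * Poly_Mapping.single (Word gs) 1 = Poly_Mapping.single (Word gs) c"
      by (simp add: free_scal_def mult_single)
    then show ?thesis using mult[OF scal word, of c gs] Word by simp
  qed
  show ?thesis
  proof (induction x rule: update_induct)
    case const
    then show ?case using single[of 0 0] by simp
  next
    case (update f w c)
    have "Poly_Mapping.update w c f = Poly_Mapping.single w c + f"
      using update(1)
      by (intro poly_mapping_eqI) (auto simp: lookup_update lookup_add lookup_single when_def in_keys_iff)
    then show ?case using add[OF single update(3)] by simp
  qed
qed

locale onsager_representation = scalar_space scale
  for scale :: "'a::field \<Rightarrow> 'b::ab_group_add \<Rightarrow> 'b" (infixr \<open>*s\<close> 75) +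
  fixes q :: 'a and \<rho> :: "'a onsager_free set \<Rightarrow> 'b \<Rightarrow> 'b"
  assumes module: "onsager_module scale q \<rho>"
begin

definition act :: "'a onsager_free \<Rightarrow> 'b \<Rightarrow> 'b" where
  "act x = \<rho> (onsager_class q x)"

lemma \<rho>_hom: "\<rho> \<in> ring_hom (onsager_algebra q) (End_ring scale)"
  using module by (simp add: onsager_module_def)

lemma class_carrier: "onsager_class q x \<in> carrier (onsager_algebra q)"
  by (rule ring_hom_closed[OF onsager_class_hom]) (simp add: carrier_ring_of_type_algebra)

lemma endo_act: "endo (act x)"
  using ring_hom_closed[OF \<rho>_hom class_carrier] by (simp add: act_def End_ring_def)

lemma act_add: "act (x + y) v = act x v + act y v"
proof -
  have "onsager_class q (x + y) = onsager_class q x \<oplus>\<^bsub>onsager_algebra q\<^esub> onsager_class q y"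
    using ring_hom_add[OF onsager_class_hom, of x y q] by (simp add: ring_of_type_algebra_def)
  then show ?thesis
    using ring_hom_add[OF \<rho>_hom class_carrier class_carrier, of x y] by (simp add: act_def End_ring_def)
qed

lemma act_mult: "act (x * y) v = act x (act y v)"
proof -
  have "onsager_class q (x * y) = onsager_class q x \<otimes>\<^bsub>onsager_algebra q\<^esub> onsager_class q y"
    using ring_hom_mult[OF onsager_class_hom, of x y q] by (simp add: ring_of_type_algebra_def)
  then show ?thesis
    using ring_hom_mult[OF \<rho>_hom class_carrier class_carrier, of x y] by (simp add: act_def End_ring_def)
qed

lemma act_scal: "act (free_scal c) v = c *s v"
  using module by (simp add: onsager_module_def act_def)

lemma act_zero: "act 0 v = 0"
  using act_add[of 0 0 v] by simp

lemma act_diff: "act (x - y) v = act x v - act y v"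
  using act_add[of "x - y" y v] by (simp add: algebra_simps)

lemmas act_simps = act_add act_mult act_scal act_diff

text \<open>
  Irreducibility quantifies over the whole quotient algebra; it suffices to test the two generators.
\<close>

lemma invariant_subspace:
  assumes "subspace S" "act (free_gen Gen_A) ` S \<subseteq> S" "act (free_gen Gen_Astar) ` S \<subseteq> S"
    and "x \<in> carrier (onsager_algebra q)"
  shows "\<rho> x ` S \<subseteq> S"
proof -
  have "\<forall>v\<in>S. act y v \<in> S" for y
  proof (induction y rule: free_algebra_induct)
    case (2 g)
    then show ?case using assms(2,3) by (cases g) auto
  qed (simp_all add: act_simps subspace_scale[OF assms(1)] subspace_add[OF assms(1)])
  moreover obtain y where "x = onsager_class q y" using onsager_class_cases[OF assms(4)] .
  ultimately show ?thesis by (auto simp: act_def)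
qed

text \<open>
  On an eigenvector of \<open>A\<close> the first defining relation becomes a polynomial in \<open>A\<close> applied to
  \<open>A* v\<close>. One factor \<open>A - \<theta>\<close> can be split off, since it also occurs in the commutator
  on the right-hand side; \<open>z\<close> is the value of the other factor.
\<close>

lemma first_relation:
  fixes \<theta> :: 'a
  defines "A \<equiv> act (free_gen Gen_A)" and "Astar \<equiv> act (free_gen Gen_Astar)"
  assumes v: "A v = \<theta> *s v"
  defines "u \<equiv> Astar v"
  defines "w \<equiv> q *s A u - (inverse q * \<theta>) *s u"
  defines "z \<equiv> inverse q *s A w - (q * \<theta>) *s w + ((q\<^sup>2 - inverse (q\<^sup>2))\<^sup>2) *s u"
  shows "A z = \<theta> *s z"
proof -
  have A: "endo A" and S: "endo Astar" by (simp_all add: A_def Astar_def endo_act)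
  define g where "g x = q *s A (Astar x) - inverse q *s Astar (A x)" for x
  define P where "P x = inverse q *s A (g x) - q *s g (A x)" for x
  define c where "c = (q\<^sup>2 - inverse (q\<^sup>2))\<^sup>2"
  have "act (onsager_relator q (free_gen Gen_A) (free_gen Gen_Astar)) v = 0"
  proof -
    have "onsager_class q (onsager_relator q (free_gen Gen_A) (free_gen Gen_Astar)) = onsager_class q 0"
      by (rule onsager_class_relator) simp
    then show ?thesis using act_zero[of v] by (simp add: act_def)
  qed
  then have relator: "A (P v) - P (A v) - c *s (Astar (A v) - A (Astar v)) = 0"
    unfolding onsager_relator_def comm_def qcomm_def act_simps inverse_inverse_eq
      A_def[symmetric] Astar_def[symmetric] g_def[symmetric] P_def[symmetric] c_def[symmetric] .
  have gv: "g v = w"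
    by (simp add: g_def w_def u_def v endo_scale[OF S])
  have g_scale: "g (b *s x) = b *s g x" for b x
    by (simp add: g_def endo_scale[OF A] endo_scale[OF S] scale_right_diff_distrib mult_ac)
  have Pv: "P v = inverse q *s A w - (q * \<theta>) *s w"
    by (simp add: P_def v g_scale gv)
  have P_scale: "P (b *s x) = b *s P x" for b x
    by (simp add: P_def endo_scale[OF A] g_scale scale_right_diff_distrib mult_ac)
  have "A (P v) - \<theta> *s P v - c *s (\<theta> *s u - A u) = 0"
    using relator by (simp add: v P_scale endo_scale[OF S] u_def)
  moreover have "z = P v + c *s u" by (simp add: z_def Pv c_def)
  ultimately show ?thesis
    by (simp add: endo_add[OF A] endo_scale[OF A] scale_right_distrib scale_right_diff_distrib
        algebra_simps)
qed

end

section \<open>Reversing the orderings\<close>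

context scalar_space
begin

lemma diagonalizable_sum_eigenspaces:
  fixes d :: nat
  assumes "diagonalizable scale f" "eigenvalues scale f = c ` {..d}"
  shows "(\<Sum>j\<le>d. eigenspace scale f (c j)) = UNIV"
proof -
  obtain S where S: "endo f" "independent S" "span S = UNIV" "\<forall>b\<in>S. \<exists>c. f b = c *s b"
    using assms(1) unfolding diagonalizable_def by blast
  have "S \<subseteq> (\<Union>j\<le>d. eigenspace scale f (c j))"
  proof
    fix b assume b: "b \<in> S"
    then obtain \<mu> where \<mu>: "f b = \<mu> *s b" using S(4) by blast
    have "b \<noteq> 0" using b S(2) dependent_zero by blast
    then have "\<mu> \<in> c ` {..d}" using \<mu> assms(2) by (auto simp: eigenvalues_def)
    then show "b \<in> (\<Union>j\<le>d. eigenspace scale f (c j))" using \<mu> by (auto simp: eigenspace_def)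
  qed
  then have "span S \<subseteq> span (\<Union>j\<le>d. eigenspace scale f (c j))" by (rule span_mono)
  moreover have "(\<Sum>j\<le>d. eigenspace scale f (c j)) = span (\<Union>j\<le>d. eigenspace scale f (c j))"
    by (rule set_sum_eq_span) (simp_all add: subspace_eigenspace[OF S(1)])
  ultimately show ?thesis using S(3) by blast
qed

lemma eigenspace_nonzero:
  fixes d :: nat
  assumes "eigenvalues scale f = c ` {..d}" "j \<le> d"
  shows "eigenspace scale f (c j) \<noteq> {0}"
proof -
  have "c j \<in> eigenvalues scale f" using assms by simp
  then show ?thesis by (auto simp: eigenvalues_def eigenspace_def)
qed

lemma goes_from_to_cong:
  assumes "goes_from_to scale q d M F G"
    and "\<And>i. i \<le> d \<Longrightarrow> F i = F' i" "\<And>i. i \<le> d \<Longrightarrow> G i = G' i"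
  shows "goes_from_to scale q d M F' G'"
  using assms unfolding goes_from_to_def Let_def by simp

lemma sum_inv_image:
  fixes S :: "nat \<Rightarrow> 'b set"
  assumes "endo H" "bij H"
  shows "(\<Sum>j<n. inv_into UNIV H ` S j) = {v. H v \<in> (\<Sum>j<n. S j)}"
proof (induction n)
  case 0
  have "v = 0" if "H v = 0" for v
    using injD[OF bij_is_inj[OF assms(2)], of v 0] that endo_zero[OF assms(1)] by simp
  then show ?case using endo_zero[OF assms(1)] by (auto simp: set_zero)
next
  case (Suc n)
  have inv: "H (inv_into UNIV H y) = y" for y
    by (rule surj_f_inv_f[OF bij_is_surj[OF assms(2)]])
  have "v \<in> {v. H v \<in> (\<Sum>j<n. S j)} + inv_into UNIV H ` S n \<longleftrightarrow> H v \<in> (\<Sum>j<n. S j) + S n" for v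
  proof
    assume "v \<in> {v. H v \<in> (\<Sum>j<n. S j)} + inv_into UNIV H ` S n"
    then obtain x y where "v = x + inv_into UNIV H y" "H x \<in> (\<Sum>j<n. S j)" "y \<in> S n"
      by (elim set_plus_elim) blast
    then show "H v \<in> (\<Sum>j<n. S j) + S n"
      by (simp add: endo_add[OF assms(1)] inv set_plus_intro)
  next
    assume "H v \<in> (\<Sum>j<n. S j) + S n"
    then obtain x y where xy: "H v = x + y" "x \<in> (\<Sum>j<n. S j)" "y \<in> S n"
      by (rule set_plus_elim)
    have "H (v - inv_into UNIV H y) = x"
      by (simp add: endo_diff[OF assms(1)] inv xy(1))
    then have "(v - inv_into UNIV H y) + inv_into UNIV H y
        \<in> {v. H v \<in> (\<Sum>j<n. S j)} + inv_into UNIV H ` S n"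
      using xy by (intro set_plus_intro) auto
    then show "v \<in> {v. H v \<in> (\<Sum>j<n. S j)} + inv_into UNIV H ` S n" by simp
  qed
  then show ?case using Suc by auto
qed

lemma sum_near_reverse:
  fixes E :: "nat \<Rightarrow> 'c::comm_monoid_add"
  assumes "i \<le> d"
  shows "(\<Sum>j\<in>{j. j \<le> d \<and> j \<le> i + 1 \<and> i \<le> j + 1}. E (d - j)) =
    (\<Sum>j\<in>{j. j \<le> d \<and> j \<le> (d - i) + 1 \<and> d - i \<le> j + 1}. E j)"
  by (rule sum.reindex_bij_witness[of _ "\<lambda>j. d - j" "\<lambda>j. d - j"]) (use assms in auto)

lemma sum_all_reverse:
  fixes E :: "nat \<Rightarrow> 'c::comm_monoid_add"
  shows "(\<Sum>j\<le>d. E (d - j)) = (\<Sum>j\<le>d. E j)"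
  by (rule sum.reindex_bij_witness[of _ "\<lambda>j. d - j" "\<lambda>j. d - j"]) auto

end

lemma inj_on_reverse:
  fixes c :: "nat \<Rightarrow> 'c"
  assumes "inj_on c {..d}"
  shows "inj_on (\<lambda>j. c (d - j)) {..d}"
  by (rule inj_onI) (metis assms atMost_iff diff_diff_cancel diff_le_self inj_onD)

context tridiagonal_system
begin

lemma reverse: "tridiagonal_system scale A Astar d (\<lambda>j. \<theta> (d - j)) \<theta>star"
proof
  show "inj_on (\<lambda>j. \<theta> (d - j)) {..d}" by (rule inj_on_reverse[OF inj_\<theta>])
  show "(\<Sum>j\<le>d. eigenspace scale A (\<theta> (d - j))) = UNIV"
    using sum_all_reverse[of "\<lambda>j. eigenspace scale A (\<theta> j)" d] V_sum by simp
  show "eigenspace scale A (\<theta> (d - j)) \<noteq> {0}" if "j \<le> d" for j by (rule V_nonzero) simp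
  show "Astar v \<in> (\<Sum>j\<in>{j. j \<le> d \<and> j \<le> i + 1 \<and> i \<le> j + 1}. eigenspace scale A (\<theta> (d - j)))"
    if "i \<le> d" "v \<in> eigenspace scale A (\<theta> (d - i))" for i v
    using Astar_tridiagonal[of "d - i" v] that(2)
    unfolding sum_near_reverse[OF that(1), of "\<lambda>j. eigenspace scale A (\<theta> j)"] by simp
qed (rule endo_add[OF endo_A] endo_scale[OF endo_A] endo_add[OF endo_Astar] endo_scale[OF endo_Astar] | fact inj_\<theta>star Vstar_sum Vstar_nonzero A_tridiagonal irreducible)+

lemma reverse_star: "tridiagonal_system scale A Astar d \<theta> (\<lambda>j. \<theta>star (d - j))"
proof
  show "inj_on (\<lambda>j. \<theta>star (d - j)) {..d}" by (rule inj_on_reverse[OF inj_\<theta>star])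
  show "(\<Sum>j\<le>d. eigenspace scale Astar (\<theta>star (d - j))) = UNIV"
    using sum_all_reverse[of "\<lambda>j. eigenspace scale Astar (\<theta>star j)" d] Vstar_sum by simp
  show "eigenspace scale Astar (\<theta>star (d - j)) \<noteq> {0}" if "j \<le> d" for j
    by (rule Vstar_nonzero) simp
  show "A v \<in> (\<Sum>j\<in>{j. j \<le> d \<and> j \<le> i + 1 \<and> i \<le> j + 1}. eigenspace scale Astar (\<theta>star (d - j)))"
    if "i \<le> d" "v \<in> eigenspace scale Astar (\<theta>star (d - i))" for i v
    using A_tridiagonal[of "d - i" v] that(2)
    unfolding sum_near_reverse[OF that(1), of "\<lambda>j. eigenspace scale Astar (\<theta>star j)"] by simp
qed (rule endo_add[OF endo_A] endo_scale[OF endo_A] endo_add[OF endo_Astar] endo_scale[OF endo_Astar] | fact inj_\<theta> V_sum V_nonzero Astar_tridiagonal irreducible)+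

end

lemma (in q_racah_sequence) reverse_sequence: "q_racah_sequence q (inverse a) d (\<lambda>j. \<theta> (d - j))"
proof
  show "inj_on (\<lambda>j. \<theta> (d - j)) {..d}" by (rule inj_on_reverse[OF distinct_\<theta>])
  show "\<theta> (d - i) = inverse a * q powi (int d - 2 * int i) +
      inverse (inverse a) * q powi (2 * int i - int d)" if "i \<le> d" for i
    using \<theta>_form[of "d - i"] that by (simp add: of_nat_diff add.commute)
qed (use q_nonzero q_not_root a_nonzero in auto)

context q_conjugating_system
begin

lemma reverse_system:
  "q_conjugating_system scale A Astar d (\<lambda>j. \<theta> (d - j)) \<theta>star q (inverse a) H (\<lambda>j. h (d - j))"
proof -
  interpret r: tridiagonal_system scale A Astar d "\<lambda>j. \<theta> (d - j)" \<theta>star by (rule reverse)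
  interpret s: q_racah_sequence q "inverse a" d "\<lambda>j. \<theta> (d - j)" by (rule reverse_sequence)
  show ?thesis
  proof
    show "H v = h (d - i) *s v" if "i \<le> d" "v \<in> eigenspace scale A (\<theta> (d - i))" for i v
      by (rule H_eigen) (use that in simp_all)
    show "h (d - i) \<noteq> 0" if "i \<le> d" for i by (rule h_nonzero) simp
    show "h (d - Suc i) = h (d - i) * ((inverse a)\<^sup>2 * (s.Q i * s.Q (Suc i)))" if "i < d" for i
    proof -
      define k where "k = d - Suc i"
      have k: "d - i = Suc k" "k < d" "i = d - Suc k" "Suc i = d - k" "k \<le> d" "Suc k \<le> d"
        using that by (simp_all add: k_def)
      have sQ: "s.Q i = inverse (Q (Suc k))" "s.Q (Suc i) = inverse (Q k)"
        using Q_reverse[OF k(6)] Q_reverse[OF k(5)] k(3,4) by simp_all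
      \<comment> \<open>The recursion for the original ordering read backwards, at k = d - i - 1.\<close>
      have "h (Suc k) * ((inverse a)\<^sup>2 * (inverse (Q (Suc k)) * inverse (Q k))) =
          h k * ((a * inverse a)\<^sup>2 * (Q k * inverse (Q k)) * (Q (Suc k) * inverse (Q (Suc k))))"
        unfolding h_Suc[OF k(2)] power_mult_distrib by (simp only: mult_ac)
      also have "\<dots> = h k" using a_nonzero Q_nonzero by simp
      finally show ?thesis unfolding sQ k(1) by (simp add: k_def)
    qed
  qed (rule endo_add[OF endo_H] endo_scale[OF endo_H])+
qed

lemma reverse_star_system:
  "q_conjugating_system scale A Astar d \<theta> (\<lambda>j. \<theta>star (d - j)) q a H h"
proof -
  interpret r: tridiagonal_system scale A Astar d \<theta> "\<lambda>j. \<theta>star (d - j)" by (rule reverse_star)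
  show ?thesis
    by unfold_locales (rule endo_add[OF endo_H] endo_scale[OF endo_H] | fact H_eigen h_nonzero h_Suc)+
qed

end

section \<open>The maps between the flags\<close>

lemma decomp_map_cong:
  assumes "\<And>i. i \<le> d \<Longrightarrow> W i = W' i"
  shows "decomp_map scale q d W = decomp_map scale q d W'"
  unfolding decomp_map_def using assms by (simp cong: conj_cong)

context q_conjugating_system
begin

text \<open>
  Everything for the maps that start at one end of \<open>V*\<close>. The flags and decompositions are
  parameters tied down only for indices up to \<open>d\<close>, as \<open>goes_from_to\<close> and \<open>decomp_map\<close> see
  no others; beyond \<open>d\<close> the reversed and the original sums differ.
\<close>

lemma flag_transitions:
  fixes V BW KW Fs Fp :: "nat \<Rightarrow> 'b set" and M M' :: "'b \<Rightarrow> 'b"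
  assumes d: "1 \<le> d" and V: "V = (\<lambda>i. eigenspace scale A (\<theta> i))"
    and BW: "\<And>i. i \<le> d \<Longrightarrow> BW i = Fs i \<inter> (\<Sum>j\<le>d-i. V j)"
    and KW: "\<And>i. i \<le> d \<Longrightarrow> KW i = Fs i \<inter> (\<Sum>j\<in>{i..d}. V j)"
    and Fs: "\<And>i. i \<le> d \<Longrightarrow> Fs i = Ustar (Suc i)"
    and Fp: "\<And>i. i \<le> d \<Longrightarrow> Fp i = Uplus (Suc i)"
    and M: "M = decomp_map scale q d BW" and M': "M' = decomp_map scale q d KW"
  shows "goes_from_to scale q d M Fs (flag_up V)"
    and "goes_from_to scale q d M' Fs (flag_down d V)"
    and "goes_from_to scale q d (\<lambda>v. a *s A v - a\<^sup>2 *s inv_into UNIV M v) Fp (flag_up V)"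
    and "goes_from_to scale q d
      (\<lambda>v. inverse a *s A v - inverse (a\<^sup>2) *s inv_into UNIV M' v) Fp (flag_down d V)"
    and "goes_from_to scale q d (\<lambda>v. inverse (inverse a - a) *s
      (inverse a *s inv_into UNIV M' v - a *s inv_into UNIV M v)) Fp Fs"
proof -
  interpret r: q_conjugating_system scale A Astar d "\<lambda>j. \<theta> (d - j)" \<theta>star q "inverse a" H "\<lambda>j. h (d - j)"
    by (rule reverse_system)
  have up: "U (Suc i) = flag_up V i" for i
    by (simp only: U_def flag_up_def V lessThan_Suc_atMost)
  have down: "r.U (Suc i) = flag_down d V i" if "i \<le> d" for i
    unfolding r.U_def flag_down_def V by (rule sum_atMost_reverse[OF that, symmetric])
  have M_B: "M = B"
    unfolding M B_def
  proof (rule decomp_map_cong)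
    fix i assume "i \<le> d"
    then show "BW i = W i"
      by (simp only: BW Fs W_def up flag_up_def)
  qed
  have M'_B: "M' = r.B"
    unfolding M' r.B_def
  proof (rule decomp_map_cong)
    fix i assume i: "i \<le> d"
    then have "r.U (Suc (d - i)) = (\<Sum>j\<in>{i..d}. V j)"
      using down[of "d - i"] by (simp add: flag_down_def)
    then show "KW i = r.W i"
      using i by (simp only: KW Fs r.W_def)
  qed
  show "goes_from_to scale q d M Fs (flag_up V)"
    unfolding M_B by (rule goes_from_to_cong[OF B_goes_from_to]) (simp_all only: Fs up)
  show "goes_from_to scale q d M' Fs (flag_down d V)"
    unfolding M'_B by (rule goes_from_to_cong[OF r.B_goes_from_to]) (simp_all only: Fs down)
  have Bplus: "(\<lambda>v. a *s A v - a\<^sup>2 *s inv_into UNIV M v) = Bplus"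
    by (rule ext) (simp only: Bplus_def Binv_def M_B)
  show "goes_from_to scale q d (\<lambda>v. a *s A v - a\<^sup>2 *s inv_into UNIV M v) Fp (flag_up V)"
    unfolding Bplus by (rule goes_from_to_cong[OF Bplus_goes_from_to]) (simp_all only: Fp up)
  have rBplus: "(\<lambda>v. inverse a *s A v - inverse (a\<^sup>2) *s inv_into UNIV M' v) = r.Bplus"
    by (rule ext) (simp only: r.Bplus_def r.Binv_def M'_B power_inverse)
  show "goes_from_to scale q d
      (\<lambda>v. inverse a *s A v - inverse (a\<^sup>2) *s inv_into UNIV M' v) Fp (flag_down d V)"
    unfolding rBplus by (rule goes_from_to_cong[OF r.Bplus_goes_from_to]) (simp_all only: Fp down)
  define c where "c = inverse (inverse a - a)"
  define N where "N v = (c * inverse a) *s r.Binv v - (c * a) *s Binv v" for v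
  have N: "(\<lambda>v. inverse (inverse a - a) *s
      (inverse a *s inv_into UNIV M' v - a *s inv_into UNIV M v)) = N"
    by (rule ext)
      (simp only: N_def c_def r.Binv_def Binv_def M_B M'_B scale_right_diff_distrib scale_scale)
  have "a\<^sup>2 * (Q 0 * Q d) \<noteq> 1" by (rule Q_product) (use d in simp_all)
  moreover have "Q 0 * Q d = 1" using Q_reverse[of 0] Q_nonzero[of 0] by simp
  ultimately have "inverse a - a \<noteq> 0" using a_nonzero by (auto simp: field_simps power2_eq_square)
  then have c: "c * inverse a - c * a = 1"
    unfolding c_def right_diff_distrib[symmetric] by (rule left_inverse)
  \<comment> \<open>The coefficients of N sum to one, so N inherits any diagonal common to its two terms.\<close>
  have c_Q: "c * inverse a * x - c * a * x = x" for x
    unfolding left_diff_distrib[symmetric] c by simp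
  have endo_N: "endo N"
    unfolding N_def[abs_def] by (rule endo_scaled_diff[OF r.endo_Binv endo_Binv])
  have "triangular d Ustar N (\<lambda>i. inverse (Q i))"
    using triangular_scaled_diff[OF flag_Ustar r.triangular_Binv_Ustar triangular_Binv_Ustar,
        of "c * inverse a" "c * a"]
    by (simp only: c_Q N_def[abs_def])
  moreover have "N = (\<lambda>v. (c * inverse a) *s Bplus v - (c * a) *s r.Bplus v)"
  proof
    fix v
    have "(c * inverse a) *s Bplus v - (c * a) *s r.Bplus v =
        (c * inverse a * a - c * a * inverse a) *s A v
        + (c * (a * inverse a) * inverse a) *s r.Binv v - (c * (inverse a * a) * a) *s Binv v"
      by (simp add: Bplus_def r.Bplus_def scale_right_diff_distrib scale_left_diff_distrib
          power2_eq_square mult_ac)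
    also have "\<dots> = N v" using a_nonzero by (simp add: N_def)
    finally show "N v = (c * inverse a) *s Bplus v - (c * a) *s r.Bplus v" ..
  qed
  then have "triangular d Uplus N Q"
    using triangular_scaled_diff[OF flag_Uplus triangular_Bplus_Uplus r.triangular_Bplus_Uplus,
        of "c * inverse a" "c * a"]
    by (simp only: c_Q)
  ultimately have "goes_from_to scale q d N (\<lambda>i. Uplus (Suc i)) (\<lambda>i. Ustar (Suc i))"
    unfolding inverse_Q unfolding Q_def[abs_def]
    by (intro goes_from_toI[OF endo_N flag_Uplus flag_Ustar _ _ inj_Q]) (simp_all only:)
  then show "goes_from_to scale q d (\<lambda>v. inverse (inverse a - a) *s
      (inverse a *s inv_into UNIV M' v - a *s inv_into UNIV M v)) Fp Fs"
    unfolding N by (rule goes_from_to_cong) (simp_all only: Fs Fp)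
qed

end

text \<open>
  By the first relation the component of \<open>A* v\<close> in the eigenspace of index \<open>j\<close> is annihilated by
  a scalar which is nonzero unless \<open>j\<close> is within one of \<open>i\<close>.
\<close>

lemma (in onsager_representation) Astar_tridiagonal:
  fixes A Astar :: "'b \<Rightarrow> 'b" and \<theta> :: "nat \<Rightarrow> 'a"
  defines "A \<equiv> act (free_gen Gen_A)" and "Astar \<equiv> act (free_gen Gen_Astar)"
  assumes racah: "q_racah_sequence q a d \<theta>"
    and sum: "(\<Sum>j\<le>d. eigenspace scale A (\<theta> j)) = UNIV"
    and i: "i \<le> d" and v: "v \<in> eigenspace scale A (\<theta> i)"
  shows "Astar v \<in> (\<Sum>j\<in>{j. j \<le> d \<and> j \<le> i + 1 \<and> i \<le> j + 1}. eigenspace scale A (\<theta> j))"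
proof -
  interpret q_racah_sequence q a d \<theta> by (rule racah)
  have A: "endo A" by (simp add: A_def endo_act)
  define u where "u = Astar v"
  have "u \<in> (\<Sum>j\<le>d. eigenspace scale A (\<theta> j))" by (simp add: sum)
  then obtain s where s: "\<forall>j\<le>d. s j \<in> eigenspace scale A (\<theta> j)" and u: "u = (\<Sum>j\<le>d. s j)"
    by (auto simp: set_sum_alt)
  have As: "A (s j) = \<theta> j *s s j" if "j \<le> d" for j
    using s that by (simp add: eigenspace_def)
  define p where "p x = (inverse q * x - q * \<theta> i) * (q * x - inverse q * \<theta> i) + (q\<^sup>2 - inverse (q\<^sup>2))\<^sup>2" for x
  define w where "w = q *s A u - (inverse q * \<theta> i) *s u"
  define z where "z = inverse q *s A w - (q * \<theta> i) *s w + ((q\<^sup>2 - inverse (q\<^sup>2))\<^sup>2) *s u"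
  have "A v = \<theta> i *s v" using v by (simp add: eigenspace_def)
  then have Az: "A z = \<theta> i *s z"
    unfolding z_def w_def u_def A_def Astar_def by (rule first_relation)
  have w: "w = (\<Sum>j\<le>d. (q * \<theta> j - inverse q * \<theta> i) *s s j)"
    unfolding w_def u endo_sum[OF A] scale_sum_right sum_subtractf[symmetric]
    by (rule sum.cong) (simp_all add: As scale_left_diff_distrib)
  have z: "z = (\<Sum>j\<le>d. p (\<theta> j) *s s j)"
    unfolding z_def w u endo_sum[OF A] scale_sum_right sum_subtractf[symmetric] sum.distrib[symmetric]
    by (rule sum.cong)
      (simp_all add: As endo_scale[OF A] p_def scale_left_diff_distrib[symmetric]
        scale_left_distrib[symmetric] left_diff_distrib right_diff_distrib mult_ac)
  have "(\<Sum>j\<le>d. ((\<theta> j - \<theta> i) * p (\<theta> j)) *s s j) = A z - \<theta> i *s z"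
    unfolding z endo_sum[OF A] scale_sum_right sum_subtractf[symmetric]
    by (rule sum.cong) (simp_all add: As endo_scale[OF A] algebra_simps)
  also have "\<dots> = 0" using Az by simp
  finally have zero: "(\<Sum>j<Suc d. ((\<theta> j - \<theta> i) * p (\<theta> j)) *s s j) = 0"
    by (simp only: lessThan_Suc_atMost)
  have inj: "inj_on \<theta> {..<Suc d}" using distinct_\<theta> by (simp only: lessThan_Suc_atMost)
  have far: "s j = 0" if j: "j \<le> d" "\<not> (j \<le> i + 1 \<and> i \<le> j + 1)" for j
  proof -
    have "((\<theta> j - \<theta> i) * p (\<theta> j)) *s s j = 0"
    proof (rule independent_eigenvectors[OF A inj _ zero])
      show "A (((\<theta> k - \<theta> i) * p (\<theta> k)) *s s k) = \<theta> k *s ((\<theta> k - \<theta> i) * p (\<theta> k)) *s s k"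
        if "k < Suc d" for k
        using that As[of k] by (simp add: endo_scale[OF A] mult_ac)
    qed (use j in simp)
    moreover have "\<theta> j \<noteq> \<theta> i" using inj_onD[OF distinct_\<theta>, of j i] j i by auto
    moreover have "p (\<theta> j) \<noteq> 0"
      unfolding p_def by (rule eigenvalue_quadratic_nonzero) (use i j in linarith)+
    ultimately show ?thesis by simp
  qed
  have "u = (\<Sum>j\<in>{j. j \<le> d \<and> j \<le> i + 1 \<and> i \<le> j + 1}. s j)"
    unfolding u by (rule sum.mono_neutral_right) (use far in auto)
  then show ?thesis
    unfolding u_def[symmetric] using s by (subst set_sum_alt) auto
qed

theorem theorem8p1:
  fixes scale :: "'f::field \<Rightarrow> 'v::ab_group_add \<Rightarrow> 'v"
    and q a :: 'f
    and \<rho> :: "('f onsager_free) set \<Rightarrow> 'v \<Rightarrow> 'v"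
    and A Astar K B Kdown Bdown H N Ndown :: "'v \<Rightarrow> 'v"
    and d :: nat
    and \<theta> \<theta>star :: "nat \<Rightarrow> 'f"
    and V Vstar Vplus :: "nat \<Rightarrow> 'v set"
  assumes q_nonzero: "q \<noteq> 0"
    and q_not_root: "\<forall>n::nat. n \<ge> 1 \<longrightarrow> q ^ n \<noteq> 1"
    and irred: "irreducible_onsager_module scale q \<rho>"
    and fin_dim: "finite_dim_space scale"
    and dim_ge: "vector_space.dim scale (UNIV :: 'v set) \<ge> 2"
    and A_def: "A = \<rho> (onsager_class q (free_gen Gen_A))"
    and Astar_def: "Astar = \<rho> (onsager_class q (free_gen Gen_Astar))"
    and A_diag: "diagonalizable scale A"
    and Astar_diag: "diagonalizable scale Astar"
    \<comment> \<open>the fixed ordering of the eigenvalues of \<open>A\<close>\<close>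
    and d_ge: "d \<ge> 1"
    and a_nonzero: "a \<noteq> 0"
    and \<theta>_def: "\<theta> = (\<lambda>i. a * q powi (int d - 2 * int i) + inverse a * q powi (2 * int i - int d))"
    and \<theta>_distinct: "inj_on \<theta> {..d}"
    and \<theta>_eigenvalues: "eigenvalues scale A = \<theta> ` {..d}"
    and V_def: "V = (\<lambda>i. eigenspace scale A (\<theta> i))"
    \<comment> \<open>the fixed ordering of the eigenspaces of \<open>Astar\<close>\<close>
    and \<theta>star_distinct: "inj_on \<theta>star {..d}"
    and \<theta>star_eigenvalues: "eigenvalues scale Astar = \<theta>star ` {..d}"
    and Vstar_def: "Vstar = (\<lambda>i. eigenspace scale Astar (\<theta>star i))"
    and Vstar_tridiagonal: "\<forall>i\<le>d. A ` Vstar i \<subseteq> (\<Sum>j\<in>{j. j \<le> d \<and> j \<le> i + 1 \<and> i \<le> j + 1}. Vstar j)"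
    and H_def: "H = H_map scale q d \<theta> V"
    and Vplus_def: "Vplus = (\<lambda>i. inv_into UNIV H ` Vstar i)"
    and K_def: "K = decomp_map scale q d (\<lambda>i. (\<Sum>j\<le>i. Vstar j) \<inter> (\<Sum>j\<in>{i..d}. V j))"
    and B_def: "B = decomp_map scale q d (\<lambda>i. (\<Sum>j\<le>i. Vstar j) \<inter> (\<Sum>j\<le>d-i. V j))"
    and Kdown_def: "Kdown = decomp_map scale q d (\<lambda>i. (\<Sum>j\<in>{d-i..d}. Vstar j) \<inter> (\<Sum>j\<in>{i..d}. V j))"
    and Bdown_def: "Bdown = decomp_map scale q d (\<lambda>i. (\<Sum>j\<in>{d-i..d}. Vstar j) \<inter> (\<Sum>j\<le>d-i. V j))"
    and N_def: "N = (\<lambda>v. scale (inverse (inverse a - a))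
                        (scale (inverse a) (inv_into UNIV K v) - scale a (inv_into UNIV B v)))"
    and Ndown_def: "Ndown = (\<lambda>v. scale (inverse (inverse a - a))
                        (scale (inverse a) (inv_into UNIV Kdown v) - scale a (inv_into UNIV Bdown v)))"
  shows
    "(goes_from_to scale q d B (flag_up Vstar) (flag_up V) \<and>
      goes_from_to scale q d K (flag_up Vstar) (flag_down d V) \<and>
      goes_from_to scale q d Bdown (flag_down d Vstar) (flag_up V) \<and>
      goes_from_to scale q d Kdown (flag_down d Vstar) (flag_down d V))
   \<and> (goes_from_to scale q d (\<lambda>v. scale a (A v) - scale (a\<^sup>2) (inv_into UNIV B v))
        (flag_up Vplus) (flag_up V) \<and>
      goes_from_to scale q d (\<lambda>v. scale (inverse a) (A v) - scale (inverse (a\<^sup>2)) (inv_into UNIV K v))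
        (flag_up Vplus) (flag_down d V) \<and>
      goes_from_to scale q d (\<lambda>v. scale a (A v) - scale (a\<^sup>2) (inv_into UNIV Bdown v))
        (flag_down d Vplus) (flag_up V) \<and>
      goes_from_to scale q d (\<lambda>v. scale (inverse a) (A v) - scale (inverse (a\<^sup>2)) (inv_into UNIV Kdown v))
        (flag_down d Vplus) (flag_down d V))
   \<and> (goes_from_to scale q d N (flag_up Vplus) (flag_up Vstar) \<and>
      goes_from_to scale q d Ndown (flag_down d Vplus) (flag_down d Vstar))"
proof -
  have module: "onsager_module scale q \<rho>"
    and irreducible: "\<And>W. module.subspace scale W \<Longrightarrow>
      \<forall>x\<in>carrier (onsager_algebra q). \<rho> x ` W \<subseteq> W \<Longrightarrow> W = {0} \<or> W = UNIV"
    using irred unfolding irreducible_onsager_module_def by blast+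
  interpret vector_space scale using module by (simp add: onsager_module_def)
  interpret rep: onsager_representation scale q \<rho> by unfold_locales (rule module)
  have A: "A = rep.act (free_gen Gen_A)" and Astar: "Astar = rep.act (free_gen Gen_Astar)"
    by (rule ext, simp add: A_def Astar_def rep.act_def)+
  have endo: "Vector_Spaces.linear scale scale A" "Vector_Spaces.linear scale scale Astar"
    unfolding A Astar by (rule rep.endo_act)+
  interpret racah: q_racah_sequence q a d \<theta>
    by unfold_locales (use q_nonzero q_not_root a_nonzero \<theta>_distinct in \<open>simp_all add: \<theta>_def\<close>)
  have V_sum: "(\<Sum>j\<le>d. eigenspace scale A (\<theta> j)) = UNIV"
    by (rule rep.diagonalizable_sum_eigenspaces[OF A_diag \<theta>_eigenvalues])
  interpret tridiagonal_system scale A Astar d \<theta> \<theta>star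
  proof
    show "(\<Sum>j\<le>d. eigenspace scale Astar (\<theta>star j)) = UNIV"
      by (rule rep.diagonalizable_sum_eigenspaces[OF Astar_diag \<theta>star_eigenvalues])
    show "eigenspace scale A (\<theta> j) \<noteq> {0}" if "j \<le> d" for j
      by (rule rep.eigenspace_nonzero[OF \<theta>_eigenvalues that])
    show "eigenspace scale Astar (\<theta>star j) \<noteq> {0}" if "j \<le> d" for j
      by (rule rep.eigenspace_nonzero[OF \<theta>star_eigenvalues that])
    show "Astar v \<in> (\<Sum>j\<in>{j. j \<le> d \<and> j \<le> i + 1 \<and> i \<le> j + 1}. eigenspace scale A (\<theta> j))"
      if "i \<le> d" "v \<in> eigenspace scale A (\<theta> i)" for i v
      using V_sum that unfolding A Astar
      by (rule rep.Astar_tridiagonal[OF racah.q_racah_sequence_axioms])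
    show "A v \<in> (\<Sum>j\<in>{j. j \<le> d \<and> j \<le> i + 1 \<and> i \<le> j + 1}. eigenspace scale Astar (\<theta>star j))"
      if "i \<le> d" "v \<in> eigenspace scale Astar (\<theta>star i)" for i v
      using Vstar_tridiagonal that unfolding Vstar_def by blast
    show "S = {0} \<or> S = UNIV" if "subspace S" "A ` S \<subseteq> S" "Astar ` S \<subseteq> S" for S
      using irreducible[OF that(1)] rep.invariant_subspace[OF that[unfolded A Astar]] by blast
  qed (rule rep.endo_add[OF endo(1)] rep.endo_scale[OF endo(1)] rep.endo_add[OF endo(2)]
      rep.endo_scale[OF endo(2)] \<theta>_distinct \<theta>star_distinct V_sum)+
  \<comment> \<open>The defining descriptions of the projections, hence of H, make sense for the eigenspaces of A.\<close>
  have V_decomposition: "rep.decomposition d V"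
    unfolding V_def by (rule rep.decomposition_eigenspaces[OF endo(1) \<theta>_distinct V_sum])
  have H: "Vector_Spaces.linear scale scale H"
    "\<And>i v. i \<le> d \<Longrightarrow> v \<in> eigenspace scale A (\<theta> i) \<Longrightarrow> H v = scale (t_coeff q \<theta> i) v"
    unfolding H_def using rep.H_map_eigen[OF V_decomposition] by (simp_all add: V_def)
  interpret conj: q_conjugating_system scale A Astar d \<theta> \<theta>star q a H "t_coeff q \<theta>"
    by unfold_locales (rule rep.endo_add[OF H(1)] rep.endo_scale[OF H(1)] H(2)
        racah.t_coeff_nonzero racah.t_coeff_Suc; assumption?)+
  interpret down: q_conjugating_system scale A Astar d \<theta> "\<lambda>j. \<theta>star (d - j)" q a H "t_coeff q \<theta>"
    by (rule conj.reverse_star_system)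
  have star_up: "flag_up Vstar i = Ustar (Suc i)" for i
    by (simp only: flag_up_def Ustar_def Vstar_def lessThan_Suc_atMost)
  have star_down: "flag_down d Vstar i = down.Ustar (Suc i)" if "i \<le> d" for i
    unfolding flag_down_def down.Ustar_def Vstar_def by (rule rep.sum_atMost_reverse[OF that])
  have plus_up: "flag_up Vplus i = conj.Uplus (Suc i)" for i
    unfolding flag_up_def lessThan_Suc_atMost[symmetric] Vplus_def Vstar_def conj.Uplus_def Ustar_def
    by (rule rep.sum_inv_image[OF H(1) conj.bij_H])
  have plus_down: "flag_down d Vplus i = down.Uplus (Suc i)" if "i \<le> d" for i
    unfolding flag_down_def rep.sum_atMost_reverse[OF that] Vplus_def Vstar_def down.Uplus_def down.Ustar_def
    by (rule rep.sum_inv_image[OF H(1) conj.bij_H])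
  note up = conj.flag_transitions[where V = V and Fs = "flag_up Vstar" and Fp = "flag_up Vplus",
      OF d_ge V_def _ _ star_up plus_up B_def K_def, folded flag_up_def]
  note down = down.flag_transitions[where V = V and Fs = "flag_down d Vstar" and Fp = "flag_down d Vplus",
      OF d_ge V_def _ _ star_down plus_down Bdown_def Kdown_def]
  show ?thesis
    unfolding N_def Ndown_def
    using up down by (simp add: flag_up_def flag_down_def)
qed

end
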